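(* Let $\lambda$ be a partition and $N=|\lambda|$. The expression $K^{\natural}(n,y)/\kappa^{(\lambda)}_N(n)$ is a polynomial in $y$ of degree $N$ whose coefficients are polynomials in $n$ and whose coefficient of $y^0$ equals $1$. The difference operator $K^{\natural}(n,y\,\mathsf S_n^{-2})$ maps sequences with support in $\mathbb N_0$ to sequences with support in $\mathcal I^{(\lambda)}$. Moreover, $$\kappa^{(\lambda)}_N(n)\,H^{(\lambda)}_n(x,y)=K^{\natural}(n,y\,\mathsf S_n^{-2})\,H_n(x,y),\qquad n\in\mathcal I^{(\lambda)}.$$
   Context: A partition $\lambda$ is a sequence of non-negative integers $\lambda_1\ge\lambda_2\ge\cdots$ with $|\lambda|=\sum_i\lambda_i<\infty$; $\ell=\ell(\lambda)$ is the number of nonzero entries. Put $m_i=\lambda_i-i$ ($i\ge1$), $\mathcal M^{(\lambda)}=\{m_i\}_{i\ge1}$, $\mathcal J^{(\lambda)}=\mathbb Z\setminus\mathcal M^{(\lambda)}$, $\mathcal I^{(\lambda)}=\mathcal J^{(\lambda)}+N$, $k_i=m_i+\ell$ for $1\le i\le\ell$, and $\kappa^{(\lambda)}_N(n)=\prod_{i=1}^{N}(n-m_i-N)$. $\mathbb N_0=\{0,1,2,\dots\}$. Bivariate Hermite polynomials: $e^{xz+yz^2}=\sum_{n\ge0}H_n(x,y)z^n/n!$, and $H_n=0$ for $n<0$. Exceptional Hermite polynomials, with $\mathrm{Wr}$ the Wronskian in $x$: $$H^{(\lambda)}_n=\frac{\mathrm{Wr}[H_{k_\ell},\dots,H_{k_1},H_{n-N+\ell}]}{\prod_{i<j}(k_i-k_j)\prod_{i=1}^{\ell}(n-N+\ell-k_i)},\qquad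 n\in\mathcal I^{(\lambda)}.$$ Schur function: let $\exp(\sum_{k\ge1}t_kz^k)=\sum_{k\ge0}B_k(t_1,\dots,t_k)z^k$, $B_k=0$ for $k<0$, and $S^{(\lambda)}(t_1,\dots,t_N)=\det(B_{\lambda_i-i+j})_{i,j=1}^{\ell}$. Let $d_\lambda$ be defined by $d_\lambda/N!=\prod_{i<j}(k_i-k_j)/\prod_i k_i!$, and set $$\Phi^{(\lambda)}(x,y,z)=\frac{N!}{d_\lambda}\,S^{(\lambda)}\!\left(x-z^{-1},\,y-\tfrac12z^{-2},\,-\tfrac13z^{-3},\dots,-\tfrac1Nz^{-N}\right)\in\mathbb C[x,y,z,z^{-1}].$$ It is monic of degree $N$ in $x$; write $\Phi^{(\lambda)}=\sum_{i=0}^N\Phi_i(y,z)x^{N-i}$. Define $$K^{(\lambda)}(x,y,z)=\sum_{i=0}^N\Phi_i(y,z)\,H_{N-i}(x-2yz,-y)=\sum_{j=0}^N\sum_{i=0}^{N-j}K_{ij}\,x^iy^jz^{i+2j-N}$$ (the second expression defines the constants $K_{ij}$), and $$K^{\natural}(n,y)=\sum_{j=0}^N\sum_{i=0}^{N-j}K_{ij}\,y^j\,F_{i+2j}(n),\qquad F_k(n)=n(n-1)\cdots(n-k+1),\ F_0=1.$$ Equivalently, $\sum_{i,j}K_{ij}\,y^jz^{i+2j}\partial_z^{i+2j}z^n=K^{\natural}(n,y)z^n$. $\mathsf S_n$ is the unit shift, $\mathsf S_nf_n=f_{n+1}$; writing $K^{\natural}(n,y)=\sum_jK^{\natural}_j(n)y^j$,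 the operator $K^{\natural}(n,y\mathsf S_n^{-2})$ is $f_n\mapsto\sum_jK^{\natural}_j(n)y^jf_{n-2j}$ on sequences indexed by $n\in\mathbb Z$. *)

theory Defs
  imports
    "HOL-Computational_Algebra.Computational_Algebra"
    "Jordan_Normal_Form.Determinant"
begin

hide_const (open) Module.smult Module.module

text \<open>
  A partition is a sequence \<open>lam 1 \<ge> lam 2 \<ge> \<dots>\<close> of naturals, indexed from 1; the value \<open>lam 0\<close> is
  irrelevant. For sequences of naturals, a finite sum is the same as finite support.
\<close>

definition part_support :: "(nat \<Rightarrow> nat) \<Rightarrow> nat set" where
  "part_support lam = {i. 1 \<le> i \<and> lam i \<noteq> 0}"

definition is_partition :: "(nat \<Rightarrow> nat) \<Rightarrow> bool" where
  "is_partition lam \<longleftrightarrow> (\<forall>i\<ge>1. lam (Suc i) \<le> lam i) \<and> finite (part_support lam)"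

definition part_size :: "(nat \<Rightarrow> nat) \<Rightarrow> nat" where
  "part_size lam = (\<Sum>i\<in>part_support lam. lam i)"

definition part_len :: "(nat \<Rightarrow> nat) \<Rightarrow> nat" where
  "part_len lam = card (part_support lam)"

definition pm :: "(nat \<Rightarrow> nat) \<Rightarrow> nat \<Rightarrow> int" where
  "pm lam i = int (lam i) - int i"

definition Mset :: "(nat \<Rightarrow> nat) \<Rightarrow> int set" where
  "Mset lam = {pm lam i |i. 1 \<le> i}"

definition Jset :: "(nat \<Rightarrow> nat) \<Rightarrow> int set" where
  "Jset lam = - Mset lam"

definition Iset :: "(nat \<Rightarrow> nat) \<Rightarrow> int set" where
  "Iset lam = {j + int (part_size lam) |j. j \<in> Jset lam}"

definition pk :: "(nat \<Rightarrow> nat) \<Rightarrow> nat \<Rightarrow> int" where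
  "pk lam i = pm lam i + int (part_len lam)"

definition vander :: "(nat \<Rightarrow> nat) \<Rightarrow> complex" where
  "vander lam = (\<Prod>(i, j)\<in>{(i, j). 1 \<le> i \<and> i < j \<and> j \<le> part_len lam}. of_int (pk lam i - pk lam j))"

definition kappa :: "(nat \<Rightarrow> nat) \<Rightarrow> complex poly" where
  "kappa lam = (\<Prod>i=1..part_size lam. [:- of_int (pm lam i + int (part_size lam)), 1:])"

text \<open>
  The definitions of \<open>alg_exp\<close>, \<open>hermite\<close>, \<open>bell\<close> and \<open>schur\<close> take place in an arbitrary commutative complex algebra, whose
  structure homomorphism is the argument \<open>c\<close>. \<open>alg_exp c g\<close> is the power series \<open>exp g\<close> in \<open>z\<close>, for
  \<open>g\<close> without constant term. A function \<open>t\<close> stands for the tuple of variables \<open>t 1, t 2, \<dots>\<close>.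
\<close>

definition alg_exp :: "(complex \<Rightarrow> 'a::comm_ring_1) \<Rightarrow> 'a fps \<Rightarrow> 'a fps" where
  "alg_exp c g = fps_compose (Abs_fps (\<lambda>m. c (1 / fact m))) g"

definition hermite :: "(complex \<Rightarrow> 'a::comm_ring_1) \<Rightarrow> int \<Rightarrow> 'a \<Rightarrow> 'a \<Rightarrow> 'a" where
  "hermite c n X Y =
     (if n < 0 then 0
      else of_nat (fact (nat n)) *
             fps_nth (alg_exp c (fps_const X * fps_X + fps_const Y * fps_X ^ 2)) (nat n))"

definition bell :: "(complex \<Rightarrow> 'a::comm_ring_1) \<Rightarrow> int \<Rightarrow> (nat \<Rightarrow> 'a) \<Rightarrow> 'a" where
  "bell c k t =
     (if k < 0 then 0
      else fps_nth (alg_exp c (Abs_fps (\<lambda>i. if i = 0 then 0 else t i))) (nat k))"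

text \<open>
  Matrix indices of type \<open>mat\<close> start at 0, so the row index of the determinant is shifted by one;
  in \<open>\<lambda>\<^sub>i - i + j\<close> the shift of the column cancels against that of \<open>i\<close>.
\<close>

definition schur :: "(complex \<Rightarrow> 'a::comm_ring_1) \<Rightarrow> (nat \<Rightarrow> nat) \<Rightarrow> (nat \<Rightarrow> 'a) \<Rightarrow> 'a" where
  "schur c lam t =
     det (mat (part_len lam) (part_len lam) (\<lambda>(i, j). bell c (int (lam (Suc i)) - int i + int j) t))"

text \<open>
  \<open>\<complex>[x,y]\<close> is \<open>complex poly poly\<close>, with \<open>x\<close> the outer and \<open>y\<close> the inner variable.
  Derivatives with respect to \<open>x\<close> are then given by \<open>pderiv\<close>.
\<close>

definition Hpoly :: "int \<Rightarrow> complex poly poly" where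
  "Hpoly n = hermite (\<lambda>a. [:[:a:]:]) n [:0, 1:] [:[:0, 1:]:]"

definition wronskian :: "complex poly poly list \<Rightarrow> complex poly poly" where
  "wronskian fs =
     det (mat (length fs) (length fs) (\<lambda>(i, j). (pderiv ^^ i) (fs ! j)))"

definition exc_hermite :: "(nat \<Rightarrow> nat) \<Rightarrow> int \<Rightarrow> complex poly poly" where
  "exc_hermite lam n =
     (let l = part_len lam; n' = n - int (part_size lam) + int l in
      smult [:1 / (vander lam * (\<Prod>i=1..l. of_int (n' - pk lam i))):]
        (wronskian (map (\<lambda>i. Hpoly (pk lam i)) (rev [1..<Suc l]) @ [Hpoly n'])))"

text \<open>
  \<open>\<complex>[x,y,z,z\<^sup>-\<^sup>1]\<close> is realized inside \<open>complex poly fls poly\<close>: polynomials in \<open>x\<close> over Laurent series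
  in \<open>z\<close> over polynomials in \<open>y\<close>.
\<close>

definition cA :: "complex \<Rightarrow> complex poly fls poly" where
  "cA a = [:fls_const [:a:]:]"

definition xA :: "complex poly fls poly" where
  "xA = [:0, 1:]"

definition yA :: "complex poly fls poly" where
  "yA = [:fls_const [:0, 1:]:]"

definition zA :: "complex poly fls poly" where
  "zA = [:fls_X:]"

definition zinvA :: "complex poly fls poly" where
  "zinvA = [:fls_X_inv:]"

definition dlam :: "(nat \<Rightarrow> nat) \<Rightarrow> complex" where
  "dlam lam = fact (part_size lam) * (vander lam / (\<Prod>i=1..part_len lam. fact (nat (pk lam i))))"

definition Phi :: "(nat \<Rightarrow> nat) \<Rightarrow> complex poly fls poly" where
  "Phi lam = cA (fact (part_size lam) / dlam lam) *
     schur cA lam (\<lambda>k. (if k = 1 then xA else if k = 2 then yA else 0) - cA (1 / of_nat k) * zinvA ^ k)"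

definition Kpoly :: "(nat \<Rightarrow> nat) \<Rightarrow> complex poly fls poly" where
  "Kpoly lam = (\<Sum>i=0..part_size lam.
     [:coeff (Phi lam) (part_size lam - i):] *
       hermite cA (int (part_size lam) - int i) (xA - 2 * yA * zA) (- yA))"

text \<open>The coefficient of \<open>x\<^sup>i y\<^sup>j z\<^sup>i\<^sup>+\<^sup>2\<^sup>j\<^sup>-\<^sup>N\<close> in \<open>Kpoly lam\<close>.\<close>

definition Kcoeff :: "(nat \<Rightarrow> nat) \<Rightarrow> nat \<Rightarrow> nat \<Rightarrow> complex" where
  "Kcoeff lam i j =
     coeff (fls_nth (coeff (Kpoly lam) i) (int i + 2 * int j - int (part_size lam))) j"

definition ffact_poly :: "nat \<Rightarrow> complex poly" where
  "ffact_poly k = (\<Prod>r<k. [:- of_nat r, 1:])"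

text \<open>A polynomial in \<open>y\<close> (outer variable) over the polynomials in \<open>n\<close> (inner variable).\<close>

definition Knat :: "(nat \<Rightarrow> nat) \<Rightarrow> complex poly poly" where
  "Knat lam = (\<Sum>j=0..part_size lam. \<Sum>i=0..part_size lam - j.
     monom (smult (Kcoeff lam i j) (ffact_poly (i + 2 * j))) j)"

text \<open>
  The difference operator obtained from \<open>Q(n,y)\<close> by substituting \<open>y S\<^sub>n\<^sup>-\<^sup>2\<close> for \<open>y\<close>. It acts on sequences
  with values in a \<open>\<complex>[y]\<close>-module, where \<open>scale\<close> is the scalar multiplication of the module. For
  \<open>\<complex>[x,y]\<close> this is \<open>smult\<close>; for complex sequences and a fixed number \<open>y\<close> it is \<open>\<lambda>p a. poly p y * a\<close>.
\<close>

definition shift_op ::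
  "(complex poly \<Rightarrow> 'b::ab_group_add \<Rightarrow> 'b) \<Rightarrow> complex poly poly \<Rightarrow> (int \<Rightarrow> 'b) \<Rightarrow> int \<Rightarrow> 'b" where
  "shift_op scale Q f n =
     (\<Sum>j\<le>degree Q. scale (monom (poly (coeff Q j) (of_int n)) j) (f (n - 2 * int j)))"

end

theory Submission
  imports Defs
begin

text \<open>
  With \<open>h\<^sub>k = H\<^sub>k / k!\<close>, the shifted arguments of the Schur function turn \<open>Phi\<close> into a multiple of
  \<open>det (h\<^bsub>\<lambda>i-i+j\<^esub> - z\<^sup>-\<^sup>1 h\<^bsub>\<lambda>i-i+j-1\<^esub>)\<close>, which by row operations is the Wronskian of the \<open>h\<close> with indices \<open>k\<^sub>i\<close> and of
  \<open>exp(xz + yz\<^sup>2)\<close>, up to the factor \<open>z\<^sup>-\<^sup>l exp(-xz - yz\<^sup>2)\<close>. The passage from \<open>Phi\<close> to \<open>Kpoly\<close> is conjugation by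
  \<open>exp(y \<partial>\<^sub>x\<^sup>2)\<close>, so that \<open>z\<^sup>N Phi exp(xz + yz\<^sup>2)\<close> is \<open>exp(xz + yz\<^sup>2)\<close> acted upon by
  \<open>\<Sum> K\<^sub>i\<^sub>j y\<^sup>j z\<^sup>i\<^sup>+\<^sup>2\<^sup>j \<partial>\<^sub>z\<^sup>i\<close>. Comparing the coefficients of \<open>z\<^sup>n / n!\<close> gives the identity for the exceptional
  polynomials. At the zeros of \<open>kappa\<close> the Wronskian or
  its factor vanishes; as Hermite polynomials of distinct degrees in \<open>x\<close> are linearly independent over
  \<open>\<complex>[y]\<close>, all coefficients of \<open>Knat\<close> vanish there, which gives the divisibility and hence the statement
  on supports.
\<close>

section \<open>Exponentials and Hermite polynomials\<close>

lemma alg_exp_nth_0: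
  assumes "comm_ring_hom c"
  shows "fps_nth (alg_exp c g) 0 = (1 :: 'a :: idom)"
proof -
  interpret comm_ring_hom c by fact
  show ?thesis by (simp add: alg_exp_def)
qed

lemma alg_exp_deriv:
  fixes c :: "complex \<Rightarrow> 'a :: idom"
  assumes "comm_ring_hom c" and "fps_nth g 0 = 0"
  shows "fps_deriv (alg_exp c g) = alg_exp c g * fps_deriv g"
proof -
  interpret comm_ring_hom c by fact
  have "of_nat (Suc n) * c (1 / fact (Suc n)) = c (1 / fact n)" for n
  proof -
    have "of_nat (Suc n) * c (1 / fact (Suc n)) = c (of_nat (Suc n) * (1 / fact (Suc n)))"
      by (simp only: hom_mult hom_of_nat)
    also have "of_nat (Suc n) * (1 / fact (Suc n) :: complex) = 1 / fact n"
      by (simp add: fact_Suc del: of_nat_Suc)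
    finally show ?thesis .
  qed
  then have "fps_deriv (Abs_fps (\<lambda>m. c (1 / fact m))) = Abs_fps (\<lambda>m. c (1 / fact m))"
    by (intro fps_ext) simp
  then show ?thesis
    using fps_compose_deriv[OF assms(2)] by (metis alg_exp_def)
qed

text \<open>Positive integers are units in the algebra since \<open>c\<close> carries over their
  inverses; this replaces division when a factor \<open>of_nat (Suc n)\<close> is cancelled.\<close>

lemma hom_inverse_of_nat:
  fixes c :: "complex \<Rightarrow> 'a :: comm_ring_1"
  assumes "comm_ring_hom c"
  shows "c (1 / of_nat (Suc n)) * of_nat (Suc n) = 1"
proof -
  interpret comm_ring_hom c by fact
  have "c (1 / of_nat (Suc n)) * of_nat (Suc n) = c (1 / of_nat (Suc n) * of_nat (Suc n))"
    by (simp only: hom_mult hom_of_nat)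
  also have "1 / of_nat (Suc n) * of_nat (Suc n) = (1 :: complex)"
    by (simp del: of_nat_Suc)
  finally show ?thesis by simp
qed

text \<open>The differential equation determines each coefficient from the earlier ones. It serves
  to recognize an exponential without logarithms, as in \<open>bell_shift\<close>.\<close>

lemma alg_exp_unique:
  fixes c :: "complex \<Rightarrow> 'a :: idom"
  assumes c: "comm_ring_hom c" and g: "fps_nth g 0 = 0"
    and F0: "fps_nth F 0 = 1" and F: "fps_deriv F = F * fps_deriv g"
  shows "F = alg_exp c g"
proof (rule fps_ext)
  fix n
  show "fps_nth F n = fps_nth (alg_exp c g) n"
  proof (induction n rule: less_induct)
    case (less n)
    show ?case
    proof (cases n)
      case 0
      then show ?thesis by (simp add: F0 alg_exp_nth_0[OF c])
    next
      case (Suc m)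
      have "of_nat (Suc m) * fps_nth F (Suc m) = fps_nth (fps_deriv F) m"
        by simp
      also have "\<dots> = fps_nth (fps_deriv (alg_exp c g)) m"
        unfolding F alg_exp_deriv[OF c g] fps_mult_nth
        by (intro sum.cong refl arg_cong2[where f = "(*)"] less) (simp add: Suc)
      also have "\<dots> = of_nat (Suc m) * fps_nth (alg_exp c g) (Suc m)"
        by simp
      finally have "c (1 / of_nat (Suc m)) * of_nat (Suc m) * fps_nth F (Suc m) =
          c (1 / of_nat (Suc m)) * of_nat (Suc m) * fps_nth (alg_exp c g) (Suc m)"
        by (simp only: mult.assoc)
      then show ?thesis
        unfolding hom_inverse_of_nat[OF c] Suc by simp
    qed
  qed
qed

section \<open>Recurrence and derivative of Hermite polynomials over an algebra\<close>

lemma hermite_neg [simp]: "n < 0 \<Longrightarrow> hermite c n X Y = 0"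
  by (simp add: hermite_def)

lemma hermite_0:
  assumes "comm_ring_hom c"
  shows "hermite c 0 X Y = (1 :: 'a :: idom)"
  by (simp add: hermite_def alg_exp_nth_0[OF assms])

text \<open>Coefficients are compared in \<open>E' = (X + 2 Y z) E\<close>, where
  \<open>E = exp(X z + Y z^2)\<close>.\<close>

lemma hermite_Suc:
  fixes X Y :: "'a :: idom"
  assumes c: "comm_ring_hom c"
  shows "hermite c (int (Suc n)) X Y =
    X * hermite c (int n) X Y + 2 * of_nat n * Y * hermite c (int n - 1) X Y"
proof -
  define g where "g = fps_const X * fps_X + fps_const Y * fps_X ^ 2"
  define E where "E = alg_exp c g"
  have g0: "fps_nth g 0 = 0" by (simp add: g_def)
  have g': "fps_deriv g = fps_const X + fps_const (2 * Y) * fps_X"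
    by (simp add: g_def power2_eq_square mult_2 algebra_simps flip: fps_const_add)
  have "of_nat (Suc n) * fps_nth E (Suc n) = fps_nth (fps_deriv E) n"
    by simp
  also have "\<dots> = X * fps_nth E n + 2 * Y * (if n = 0 then 0 else fps_nth E (n - 1))"
    unfolding E_def alg_exp_deriv[OF c g0] g' by (simp add: algebra_simps flip: mult.assoc)
  finally have *: "of_nat (Suc n) * fps_nth E (Suc n) =
    X * fps_nth E n + 2 * Y * (if n = 0 then 0 else fps_nth E (n - 1))" .
  have "hermite c (int (Suc n)) X Y = of_nat (fact n) * (of_nat (Suc n) * fps_nth E (Suc n))"
    by (simp add: hermite_def E_def g_def algebra_simps nat_add_distrib)
  also have "\<dots> = X * (of_nat (fact n) * fps_nth E n) +
      2 * Y * (of_nat (fact n) * (if n = 0 then 0 else fps_nth E (n - 1)))"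
    unfolding * by (simp add: algebra_simps)
  also have "of_nat (fact n) * (if n = 0 then 0 else fps_nth E (n - 1)) =
      of_nat n * hermite c (int n - 1) X Y"
    by (cases n) (simp_all add: hermite_def E_def g_def algebra_simps)
  also have "of_nat (fact n) * fps_nth E n = hermite c (int n) X Y"
    by (simp add: hermite_def E_def g_def)
  finally show ?thesis by (simp add: algebra_simps)
qed

text \<open>Index 0 is the only exception: there the left side is 1, while both indices on the right
  are negative.\<close>

lemma hermite_rec:
  fixes X Y :: "'a :: idom"
  assumes c: "comm_ring_hom c" and "n \<noteq> 0"
  shows "hermite c n X Y =
    X * hermite c (n - 1) X Y + 2 * of_int (n - 1) * Y * hermite c (n - 2) X Y"
proof (cases "n < 0")
  case False
  then obtain m where m: "n = int (Suc m)"
    using \<open>n \<noteq> 0\<close> by (metis gr0_conv_Suc linorder_neqE of_nat_0_less_iff zero_less_imp_eq_int)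
  show ?thesis
    unfolding m hermite_Suc[OF c] by simp
qed simp

lemma alg_exp_nth_hermite:
  fixes X Y :: "'a :: idom"
  assumes "comm_ring_hom c"
  shows "fps_nth (alg_exp c (fps_const X * fps_X + fps_const Y * fps_X ^ 2)) n =
    c (1 / fact n) * hermite c (int n) X Y"
proof -
  interpret comm_ring_hom c by fact
  have "c (1 / fact n) * of_nat (fact n) = c (1 / fact n * of_nat (fact n))"
    by (simp only: hom_mult hom_of_nat)
  then show ?thesis
    by (simp add: hermite_def flip: mult.assoc)
qed

text \<open>The factor \<open>Z\<close> accounts for the weights 1 and 2 of the two arguments.\<close>

lemma hermite_hom_scaled:
  fixes X Y :: "'a :: idom" and X' Y' Z :: "'b :: idom"
  assumes c: "comm_ring_hom c" and c': "comm_ring_hom c'" and h: "comm_ring_hom h"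
    and "h X = Z * X'" "h Y = Z ^ 2 * Y'"
  shows "h (hermite c (int n) X Y) = Z ^ n * hermite c' (int n) X' Y'"
proof -
  interpret h: comm_ring_hom h by fact
  show ?thesis
  proof (induction n rule: less_induct)
    case (less n)
    show ?case
    proof (cases n)
      case 0
      then show ?thesis by (simp add: hermite_0 c c')
    next
      case (Suc m)
      have 1: "h (hermite c (int m) X Y) = Z ^ m * hermite c' (int m) X' Y'"
        using less[of m] Suc by simp
      have 2: "of_nat m * Z ^ 2 * h (hermite c (int m - 1) X Y) =
          of_nat m * Z ^ Suc m * hermite c' (int m - 1) X' Y'"
      proof (cases m)
        case (Suc k)
        then show ?thesis
          using less[of k] \<open>n = Suc m\<close> by (simp add: power2_eq_square algebra_simps)
      qed simp
      have "h (hermite c (int n) X Y) = Z * X' * h (hermite c (int m) X Y) +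
          2 * Y' * (of_nat m * Z ^ 2 * h (hermite c (int m - 1) X Y))"
        unfolding Suc hermite_Suc[OF c] using assms(4,5) by (simp add: hom_distribs algebra_simps)
      also have "\<dots> = Z ^ n * hermite c' (int n) X' Y'"
        unfolding 1 2 unfolding Suc hermite_Suc[OF c'] by (simp add: algebra_simps)
      finally show ?thesis .
    qed
  qed
qed

text \<open>Induction along the recurrence. The arguments are kept general because both
  \<open>Hpoly\<close> and the polynomials \<open>GP\<close> need the rule.\<close>

lemma pderiv_hermite:
  fixes X Y :: "'a :: idom poly"
  assumes c: "comm_ring_hom c" and X: "pderiv X = 1" and Y: "pderiv Y = 0"
  shows "pderiv (hermite c n X Y) = of_int n * hermite c (n - 1) X Y"
proof (cases "n < 0")
  case False
  have "pderiv (hermite c (int n) X Y) = of_nat n * hermite c (int n - 1) X Y" for n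
  proof (induction n rule: less_induct)
    case (less n)
    show ?case
    proof (cases n)
      case 0
      then show ?thesis by (simp add: hermite_0 c)
    next
      case (Suc m)
      have 1: "pderiv (hermite c (int m) X Y) = of_nat m * hermite c (int m - 1) X Y"
        using less[of m] Suc by simp
      have 2: "of_nat m * pderiv (hermite c (int m - 1) X Y) =
          of_nat m * of_int (int m - 1) * hermite c (int m - 2) X Y"
      proof (cases m)
        case (Suc k)
        then show ?thesis
          using less[of k] \<open>n = Suc m\<close> by simp
      qed simp
      \<comment> \<open>The recurrence fails at index 0; the factor \<open>of_nat m\<close> makes
        the equation hold there too.\<close>
      have 3: "of_nat m * hermite c (int m) X Y = of_nat m * (X * hermite c (int m - 1) X Y +
          2 * of_int (int m - 1) * Y * hermite c (int m - 2) X Y)"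
        using hermite_rec[OF c, of "int m" X Y] by (cases "m = 0") auto
      have "pderiv (hermite c (int n) X Y) =
          hermite c (int m) X Y + X * (of_nat m * hermite c (int m - 1) X Y) +
          2 * Y * (of_nat m * of_int (int m - 1) * hermite c (int m - 2) X Y)"
        unfolding Suc hermite_Suc[OF c] 2[symmetric]
        by (simp add: pderiv_add pderiv_mult pderiv_of_nat X Y 1 algebra_simps)
      also have "\<dots> = hermite c (int m) X Y + of_nat m * hermite c (int m) X Y"
        unfolding 3 by (simp add: algebra_simps)
      finally show ?thesis
        by (simp add: Suc algebra_simps)
    qed
  qed
  from this[of "nat n"] False show ?thesis by simp
qed (simp)

section \<open>Linear extension and weights\<close>

definition psupp :: "complex poly poly \<Rightarrow> (nat \<times> nat) set" where
  "psupp p = {(i, j). coeff (coeff p i) j \<noteq> 0}"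

lemma finite_psupp [simp]: "finite (psupp p)"
proof (rule finite_subset)
  show "psupp p \<subseteq> (SIGMA i:{..degree p}. {..degree (coeff p i)})"
  proof
    fix x assume "x \<in> psupp p"
    then obtain i j where x: "x = (i, j)" and ij: "coeff (coeff p i) j \<noteq> 0"
      by (auto simp: psupp_def)
    then have "coeff p i \<noteq> 0" by auto
    with ij show "x \<in> (SIGMA i:{..degree p}. {..degree (coeff p i)})"
      by (simp add: x le_degree)
  qed
qed auto

text \<open>The complex-linear map with \<open>xP ^ i * yP ^ j\<close> sent to \<open>c i j\<close>.
  Both the passage from \<open>Phi\<close> to \<open>Kpoly\<close> and the action of the operator
  are of this form.\<close>

definition lin_ext :: "(nat \<Rightarrow> nat \<Rightarrow> complex poly poly) \<Rightarrow> complex poly poly \<Rightarrow> complex poly poly" where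
  "lin_ext c p = (\<Sum>(i, j)\<in>psupp p. smult [:coeff (coeff p i) j:] (c i j))"

lemma lin_ext_superset:
  assumes "finite T" "psupp p \<subseteq> T"
  shows "lin_ext c p = (\<Sum>(i, j)\<in>T. smult [:coeff (coeff p i) j:] (c i j))"
  unfolding lin_ext_def
  by (rule sum.mono_neutral_left) (use assms in \<open>auto simp: psupp_def\<close>)

lemma lin_ext_add [simp]: "lin_ext c (p + q) = lin_ext c p + lin_ext c q"
proof -
  let ?T = "psupp p \<union> psupp q"
  have "psupp (p + q) \<subseteq> ?T" by (auto simp: psupp_def)
  moreover have "smult [:a + b:] r = smult [:a:] r + smult [:b:] r" for a b :: complex and r
    by (metis add_pCons add_0 smult_add_left)
  ultimately show ?thesis
    by (subst (1 2 3) lin_ext_superset[of ?T]) (auto simp: sum.distrib[symmetric] split_def)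
qed

lemma lin_ext_monom [simp]: "lin_ext c (monom (monom a j) i) = smult [:a:] (c i j)"
  by (subst lin_ext_superset[of "{(i, j)}"]) (auto simp: psupp_def split: if_splits)

lemma poly_poly_induct [case_names monom add]:
  fixes p :: "complex poly poly"
  assumes "\<And>a i j. P (monom (monom a j) i)" and "\<And>p q. P p \<Longrightarrow> P q \<Longrightarrow> P (p + q)"
  shows "P p"
proof -
  have sum: "P (\<Sum>i\<le>n. f i)" if "\<And>i. P (f i)" for n :: nat and f
    by (induction n) (auto intro: assms that)
  have "P (monom q i)" for q i
  proof -
    have "P (\<Sum>j\<le>degree q. monom (monom (coeff q j) j) i)"
      by (rule sum) (rule assms)
    also have "(\<Sum>j\<le>degree q. monom (monom (coeff q j) j) i) = monom q i"
      by (simp add: poly_as_sum_of_monoms flip: monom_sum)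
    finally show ?thesis .
  qed
  then have "P (\<Sum>i\<le>degree p. monom (coeff p i) i)" by (rule sum)
  then show ?thesis by (simp add: poly_as_sum_of_monoms)
qed

abbreviation xP :: "complex poly poly" where "xP \<equiv> [:0, 1:]"
abbreviation yP :: "complex poly poly" where "yP \<equiv> [:[:0, 1:]:]"

lemma xP_mult_monom: "xP * monom q i = monom q (Suc i)"
  by (metis One_nat_def monom_0 monom_Suc mult.commute mult_monom plus_1_eq_Suc mult_1_left one_pCons)

lemma yP_mult_monom: "yP * monom (monom a j) i = monom (monom a (Suc j)) i"
  by (simp add: smult_monom monom_Suc)

lemma monom_eq_xP_yP: "monom (monom a j) i = smult [:a:] (xP ^ i * yP ^ j)"
proof -
  have "yP ^ j = monom (monom 1 j) 0"
    by (induction j) (simp_all add: yP_mult_monom del: mult_pCons_left)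
  moreover have "xP ^ i * monom q 0 = monom q i" for q
    by (induction i) (simp_all add: xP_mult_monom mult.assoc del: mult_pCons_left)
  ultimately show ?thesis
    by (simp add: smult_monom)
qed

lemma lin_ext_smult [simp]: "lin_ext c (smult [:a:] p) = smult [:a:] (lin_ext c p)"
  by (induction p rule: poly_poly_induct)
    (simp_all add: smult_monom smult_add_right mult.commute)

lemma lin_ext_0 [simp]: "lin_ext c 0 = 0"
  by (simp add: lin_ext_def psupp_def)

lemma lin_ext_uminus [simp]: "lin_ext c (- p) = - lin_ext c p"
  using lin_ext_add[of c p "- p"] by (simp add: eq_neg_iff_add_eq_0 add.commute del: lin_ext_add)

lemma lin_ext_diff [simp]: "lin_ext c (p - q) = lin_ext c p - lin_ext c q"
  using lin_ext_add[of c p "- q"] by simp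

lemma lin_ext_sum: "lin_ext c (\<Sum>i\<in>A. f i) = (\<Sum>i\<in>A. lin_ext c (f i))"
  by (induction A rule: infinite_finite_induct) simp_all

text \<open>Here and in \<open>lin_ext_yP\<close> and \<open>lin_ext_pderiv\<close>, an operation on
  the argument is transposed to one on the indices of \<open>c\<close>, so that recurrences for
  families become identities between linear maps.\<close>

lemma lin_ext_xP: "lin_ext c (xP * p) = lin_ext (\<lambda>i j. c (Suc i) j) p"
  by (induction p rule: poly_poly_induct)
    (simp_all add: xP_mult_monom distrib_left del: mult_pCons_left)

lemma lin_ext_yP: "lin_ext c (yP * p) = lin_ext (\<lambda>i j. c i (Suc j)) p"
  by (induction p rule: poly_poly_induct)
    (simp_all add: yP_mult_monom distrib_left del: mult_pCons_left)

lemma lin_ext_pderiv: "lin_ext c (pderiv p) = lin_ext (\<lambda>i j. of_nat i * c (i - 1) j) p"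
proof (induction p rule: poly_poly_induct)
  case (monom a i j)
  have "pderiv (monom (monom a j) i) = monom (monom (of_nat i * a) j) (i - 1)"
    by (simp add: pderiv_monom of_nat_poly smult_monom)
  moreover have "smult [:of_nat i * a:] r = smult [:a:] (of_nat i * r)" for r :: "complex poly poly"
    by (simp add: of_nat_poly mult.commute)
  ultimately show ?case by simp
qed (simp add: pderiv_add)

lemma lin_ext_lin_ext: "lin_ext d (lin_ext c p) = lin_ext (\<lambda>i j. lin_ext d (c i j)) p"
  by (induction p rule: poly_poly_induct) simp_all

lemma lin_ext_mult: "lin_ext (\<lambda>i j. f * c i j) p = f * lin_ext c p"
  by (induction p rule: poly_poly_induct) (simp_all add: distrib_left)

lemma lin_ext_add_fun: "lin_ext (\<lambda>i j. c i j + d i j) p = lin_ext c p + lin_ext d p"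
  by (simp add: lin_ext_def split_def smult_add_right sum.distrib)

lemma lin_ext_id: "lin_ext (\<lambda>i j. xP ^ i * yP ^ j) p = p"
proof (induction p rule: poly_poly_induct)
  case (monom a i j)
  show ?case by (simp only: lin_ext_monom) (simp only: monom_eq_xP_yP)
qed simp

lemma lin_ext_cong:
  assumes "\<And>i j. coeff (coeff p i) j \<noteq> 0 \<Longrightarrow> c i j = d i j"
  shows "lin_ext c p = lin_ext d p"
  unfolding lin_ext_def by (rule sum.cong) (auto simp: psupp_def assms)

text \<open>The weights are integers so that negated weights express lower bounds: (1, 2) and (-1,
  -2) together say that \<open>p\<close> is homogeneous, and (1, 1) bounds the total degree.\<close>

definition wbound :: "int \<Rightarrow> int \<Rightarrow> int \<Rightarrow> complex poly poly \<Rightarrow> bool" where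
  "wbound a b w p \<longleftrightarrow> (\<forall>i j. coeff (coeff p i) j \<noteq> 0 \<longrightarrow> a * int i + b * int j \<le> w)"

lemma wbound_0 [simp]: "wbound a b w 0"
  by (simp add: wbound_def)

lemma wbound_mono: "wbound a b w p \<Longrightarrow> w \<le> w' \<Longrightarrow> wbound a b w' p"
  unfolding wbound_def by force

lemma wbound_add: "wbound a b w p \<Longrightarrow> wbound a b w q \<Longrightarrow> wbound a b w (p + q)"
  unfolding wbound_def by (metis add.right_neutral add_0 coeff_add)

lemma wbound_uminus [simp]: "wbound a b w (- p) \<longleftrightarrow> wbound a b w p"
  unfolding wbound_def by simp

lemma wbound_diff: "wbound a b w p \<Longrightarrow> wbound a b w q \<Longrightarrow> wbound a b w (p - q)"
  using wbound_add[of a b w p "- q"] by simp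

lemma wbound_smult: "wbound a b w p \<Longrightarrow> wbound a b w (smult [:c:] p)"
  unfolding wbound_def by simp

lemma wbound_sum: "(\<And>i. i \<in> A \<Longrightarrow> wbound a b w (f i)) \<Longrightarrow> wbound a b w (\<Sum>i\<in>A. f i)"
  by (induction A rule: infinite_finite_induct) (simp_all add: wbound_add)

lemma wbound_const: "0 \<le> w \<Longrightarrow> wbound a b w [:[:c:]:]"
  unfolding wbound_def by (auto simp: coeff_pCons split: nat.splits)

lemma wbound_of_int: "0 \<le> w \<Longrightarrow> wbound a b w (of_int n)"
  by (simp only: of_int_poly wbound_const)

lemma wbound_mult:
  assumes "wbound a b u p" "wbound a b v q"
  shows "wbound a b (u + v) (p * q)"
  unfolding wbound_def
proof (intro allI impI)
  fix i j
  assume "coeff (coeff (p * q) i) j \<noteq> 0"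
  then have "(\<Sum>k\<le>i. \<Sum>l\<le>j. coeff (coeff p k) l * coeff (coeff q (i - k)) (j - l)) \<noteq> 0"
    by (simp add: coeff_mult coeff_sum)
  then obtain k where "k \<le> i" and
    "(\<Sum>l\<le>j. coeff (coeff p k) l * coeff (coeff q (i - k)) (j - l)) \<noteq> 0"
    by (metis (no_types, lifting) atMost_iff sum.neutral)
  moreover from this(2) obtain l where "l \<le> j"
    "coeff (coeff p k) l * coeff (coeff q (i - k)) (j - l) \<noteq> 0"
    by (metis (no_types, lifting) atMost_iff sum.neutral)
  ultimately have "k \<le> i" "l \<le> j"
    "coeff (coeff p k) l \<noteq> 0" "coeff (coeff q (i - k)) (j - l) \<noteq> 0"
    by auto
  then have "a * int k + b * int l \<le> u" "a * int (i - k) + b * int (j - l) \<le> v"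
    using assms unfolding wbound_def by blast+
  then show "a * int i + b * int j \<le> u + v"
    using \<open>k \<le> i\<close> \<open>l \<le> j\<close> by (simp add: of_nat_diff algebra_simps)
qed

lemma wbound_prod:
  "(\<And>i. i \<in> A \<Longrightarrow> wbound a b (u i) (f i)) \<Longrightarrow> wbound a b (\<Sum>i\<in>A. u i) (\<Prod>i\<in>A. f i)"
  by (induction A rule: infinite_finite_induct)
    (simp_all add: wbound_mult wbound_const[of 0 _ _ 1, unfolded pCons_one])

text \<open>Each term of the Leibniz formula meets every row and every column once, so all terms
  obey the same bound.\<close>

lemma wbound_det:
  assumes M: "M \<in> carrier_mat n n"
    and w: "\<And>i j. i < n \<Longrightarrow> j < n \<Longrightarrow> wbound a b (u i + v j) (M $$ (i, j))"
  shows "wbound a b (sum u {..<n} + sum v {..<n}) (det M)"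
  unfolding det_def'[OF M]
proof (rule wbound_sum)
  fix p assume "p \<in> {p. p permutes {0..<n}}"
  then have p: "p permutes {..<n}" by (simp add: atLeast0LessThan)
  have "wbound a b (\<Sum>i<n. u i + v (p i)) (\<Prod>i<n. M $$ (i, p i))"
    by (rule wbound_prod, rule w) (use p permutes_in_image[OF p] in auto)
  also have "(\<Sum>i<n. u i + v (p i)) = sum u {..<n} + sum v {..<n}"
    by (simp add: sum.distrib sum.permute[OF p, of v] o_def)
  finally show "wbound a b (sum u {..<n} + sum v {..<n}) (signof p * (\<Prod>i = 0..<n. M $$ (i, p i)))"
    by (simp add: sign_def atLeast0LessThan)
qed

lemma comm_ring_hom_const2: "comm_ring_hom (\<lambda>a :: complex. [:[:a:]:])"
  by unfold_locales (simp_all add: one_pCons)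

abbreviation hermP :: "int \<Rightarrow> complex poly poly \<Rightarrow> complex poly poly \<Rightarrow> complex poly poly" where
  "hermP \<equiv> hermite (\<lambda>a. [:[:a:]:])"

lemma wbound_hermite:
  assumes "wbound a b u X" "wbound a b (2 * u) Y"
  shows "wbound a b (n * u) (hermP n X Y)"
proof (cases "n < 0")
  case False
  have "wbound a b (int n * u) (hermP (int n) X Y)" for n
  proof (induction n rule: less_induct)
    case (less n)
    show ?case
    proof (cases n)
      case 0
      then show ?thesis
        by (simp add: hermite_0 comm_ring_hom_const2 wbound_const[of 0 _ _ 1, unfolded pCons_one])
    next
      case (Suc m)
      have 1: "wbound a b (u + int m * u) (X * hermP (int m) X Y)"
        using less[of m] Suc by (intro wbound_mult assms) auto
      have 2: "wbound a b (u + int m * u) (of_int (2 * int m) * (Y * hermP (int m - 1) X Y))"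
      proof (cases m)
        case (Suc k)
        have "wbound a b (0 + (2 * u + int k * u)) (of_int (2 * int m) * (Y * hermP (int k) X Y))"
          using less[of k] Suc \<open>n = Suc m\<close> by (intro wbound_mult assms wbound_of_int) auto
        then show ?thesis
          by (simp add: Suc algebra_simps)
      qed simp
      show ?thesis
        using wbound_add[OF 1 2]
        unfolding Suc hermite_Suc[OF comm_ring_hom_const2] by (simp add: algebra_simps)
    qed
  qed
  from this[of "nat n"] False show ?thesis by simp
qed simp

text \<open>If \<open>Y\<close> falls short of weight \<open>2 * u\<close>, every term of the
  recurrence containing \<open>Y\<close> loses weight, and only \<open>X ^ n\<close> can reach the
  top.\<close>

lemma wbound_hermite_top:
  assumes X: "wbound a b u X" and Y: "wbound a b (2 * u - 1) Y"
  shows "wbound a b (int n * u - 1) (hermP (int n) X Y - X ^ n)"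
proof (induction n)
  case 0
  show ?case by (simp add: hermite_0 comm_ring_hom_const2)
next
  case (Suc m)
  have 1: "wbound a b (u + (int m * u - 1)) (X * (hermP (int m) X Y - X ^ m))"
    using Suc by (intro wbound_mult X)
  have "wbound a b (0 + (2 * u - 1 + (int m - 1) * u)) (of_int (2 * int m) * (Y * hermP (int m - 1) X Y))"
    by (intro wbound_mult wbound_hermite Y X wbound_of_int) (auto intro: wbound_mono Y)
  then have 2: "wbound a b (u + (int m * u - 1)) (of_int (2 * int m) * (Y * hermP (int m - 1) X Y))"
    by (simp add: algebra_simps)
  show ?case
    using wbound_add[OF 1 2]
    unfolding hermite_Suc[OF comm_ring_hom_const2] by (simp add: algebra_simps)
qed

section \<open>The operators attached to Hermite polynomials\<close>

definition ff :: "nat \<Rightarrow> int \<Rightarrow> complex" where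
  "ff k n = poly (ffact_poly k) (of_int n)"

lemma ff_0 [simp]: "ff 0 n = 1"
  by (simp add: ff_def ffact_poly_def)

lemma ff_Suc: "ff (Suc k) n = ff k n * of_int (n - int k)"
  by (simp add: ff_def ffact_poly_def algebra_simps)

lemma ff_add: "ff (a + b) n = ff a n * ff b (n - int a)"
  by (induction b) (simp_all add: ff_Suc algebra_simps)

lemma ff_1: "ff (Suc 0) n = of_int n"
  by (simp add: ff_Suc)

lemma ff_Suc': "ff (Suc k) n = of_int n * ff k (n - 1)"
  using ff_add[of 1 k n] by (simp add: ff_1)

lemma ff_eq_0: "0 \<le> n \<Longrightarrow> n < int k \<Longrightarrow> ff k n = 0"
  by (auto simp: ff_def ffact_poly_def poly_prod intro!: bexI[of _ "nat n"])

lemma ff_fact: "k \<le> n \<Longrightarrow> ff k (int n) * fact (n - k) = fact n"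
proof (induction k)
  case (Suc k)
  then have "(fact (n - k) :: complex) = of_int (int n - int k) * fact (n - Suc k)"
    by (subst Suc_diff_Suc[symmetric]) (simp_all add: of_nat_diff)
  with Suc show ?case by (simp add: ff_Suc mult.assoc)
qed simp

lemma smult_pCons_1 [simp]: "smult [:1:] p = (p :: complex poly poly)"
  using smult_1_left[of p] by (simp only: one_pCons)

lemma smult_const2: "smult [:c:] p = [:[:c:]:] * p"
  by simp

interpretation const2: comm_ring_hom "\<lambda>a :: complex. [:[:a:]:]"
  by (rule comm_ring_hom_const2)

lemma Hpoly_neg [simp]: "n < 0 \<Longrightarrow> Hpoly n = 0"
  by (simp add: Hpoly_def)

lemma Hpoly_rec:
  "n \<noteq> 0 \<Longrightarrow> Hpoly n = xP * Hpoly (n - 1) + 2 * of_int (n - 1) * yP * Hpoly (n - 2)"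
  unfolding Hpoly_def by (rule hermite_rec[OF comm_ring_hom_const2])

lemma pderiv_Hpoly: "pderiv (Hpoly n) = smult [:of_int n:] (Hpoly (n - 1))"
proof -
  have "pderiv (Hpoly n) = of_int n * Hpoly (n - 1)"
    unfolding Hpoly_def
    by (rule pderiv_hermite[OF comm_ring_hom_const2]) (simp_all add: pderiv_pCons)
  then show ?thesis by (simp add: smult_const2 const2.hom_of_int del: mult_pCons_left)
qed

lemma higher_pderiv_Hpoly: "(pderiv ^^ r) (Hpoly n) = smult [:ff r n:] (Hpoly (n - int r))"
proof (induction r)
  case (Suc r)
  then show ?case
    by (simp add: pderiv_smult pderiv_Hpoly ff_Suc diff_diff_eq add.commute mult.commute)
qed simp

text \<open>At \<open>y = 0\<close> the second term of the recurrence disappears. This is the source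
  of the linear independence over the polynomials in \<open>y\<close>.\<close>

lemma Hpoly_y0: "coeff (coeff (Hpoly (int n)) i) 0 = (if i = n then 1 else 0)"
proof (induction n arbitrary: i rule: less_induct)
  case (less n)
  show ?case
  proof (cases n)
    case 0
    then show ?thesis
      by (auto simp: Hpoly_def hermite_0 comm_ring_hom_const2 coeff_1)
  next
    case (Suc m)
    have "Hpoly (int n) = xP * Hpoly (int m) + yP * (2 * of_int (int m) * Hpoly (int m - 1))"
      using Hpoly_rec[of "int n"] Suc by (simp add: mult_ac)
    then have "coeff (coeff (Hpoly (int n)) i) 0 = coeff (coeff (xP * Hpoly (int m)) i) 0"
      by simp
    also have "\<dots> = (if i = n then 1 else 0)"
      using less[of m] Suc by (cases i) simp_all
    finally show ?thesis .
  qed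
qed

text \<open>The coefficient of \<open>z\<^sup>n / n!\<close> in \<open>y\<^sup>j z\<^sup>i\<^sup>+\<^sup>2\<^sup>j \<partial>\<^sub>z\<^sup>i exp(xz + yz\<^sup>2)\<close>.\<close>

definition cop :: "int \<Rightarrow> nat \<Rightarrow> nat \<Rightarrow> complex poly poly" where
  "cop n i j = smult [:ff (i + 2 * j) n:] (yP ^ j * Hpoly (n - 2 * int j))"

lemma cop_Suc_right: "cop n i (Suc j) = smult [:ff 2 n:] (yP * cop (n - 2) i j)"
proof -
  have "ff (i + 2 * Suc j) n = ff 2 n * ff (i + 2 * j) (n - 2)"
    using ff_add[of 2 "i + 2 * j" n] by (simp add: algebra_simps)
  then show ?thesis
    unfolding cop_def smult_const2
    by (simp add: const2.hom_mult mult_ac algebra_simps del: mult_pCons_left mult_pCons_right)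
qed

text \<open>The Hermite recurrence, arranged so that the last two terms are those that
  \<open>yP * p\<close> and \<open>yP * pderiv p\<close> produce under
  \<open>lin_ext (cop n)\<close>. The recurrence of \<open>GP\<close> subtracts exactly
  these.\<close>

lemma cop_Suc_left:
  "cop n (Suc i) j = smult [:of_int n:] (xP * cop (n - 1) i j) + 2 * cop n i (Suc j) +
     2 * (of_nat i * cop n (i - 1) (Suc j))"
proof (cases "n = 2 * int j")
  case True
  then show ?thesis by (simp add: cop_def ff_eq_0)
next
  case False
  define A where "A = ff (i + 2 * j) (n - 1)"
  define H1 where "H1 = Hpoly (n - 1 - 2 * int j)"
  define H2 where "H2 = Hpoly (n - 2 - 2 * int j)"
  have 1: "ff (Suc i + 2 * j) n = of_int n * A"
    by (simp add: ff_Suc' A_def)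
  have 2: "ff (i + 2 * Suc j) n = of_int n * A * of_int (n - 1 - int i - 2 * int j)"
  proof -
    have "i + 2 * Suc j = Suc (Suc (i + 2 * j))" by simp
    then show ?thesis
      unfolding A_def using ff_Suc[of "Suc (i + 2 * j)"] ff_Suc'[of "i + 2 * j"]
      by (simp add: algebra_simps)
  qed
  have 3: "of_nat i * cop n (i - 1) (Suc j) = of_nat i * ([:[:of_int n * A:]:] * (yP ^ Suc j * H2))"
  proof (cases i)
    case (Suc k)
    then have "i - 1 + 2 * Suc j = Suc (i + 2 * j)" by simp
    then show ?thesis
      unfolding cop_def H2_def A_def smult_const2 by (simp add: ff_Suc' algebra_simps)
  qed simp
  have H: "Hpoly (n - 2 * int j) = xP * H1 + 2 * of_int (n - 1 - 2 * int j) * yP * H2"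
    using Hpoly_rec[of "n - 2 * int j"] False by (simp add: H1_def H2_def algebra_simps)
  have 4: "n - 2 * int (Suc j) = n - 2 - 2 * int j" "n - 1 - 2 * int j = n - 2 * int j - 1" by simp_all
  show ?thesis
    unfolding 3 unfolding cop_def smult_const2 1 2 H 4(1) H2_def[symmetric]
      A_def[symmetric] H1_def[symmetric] const2.hom_mult const2.hom_of_int
    by (simp add: algebra_simps del: mult_pCons_left mult_pCons_right)
qed

text \<open>The value at \<open>z = 1\<close> of \<open>H_a(x - 2yz, -y)\<close>, which takes the
  place of \<open>x^a\<close> in \<open>Kpoly\<close>.\<close>

abbreviation GP :: "nat \<Rightarrow> complex poly poly" where
  "GP a \<equiv> hermP (int a) (xP - 2 * yP) (- yP)"

lemma pderiv_GP: "pderiv (hermP n (xP - 2 * yP) (- yP)) = of_int n * hermP (n - 1) (xP - 2 * yP) (- yP)"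
  by (rule pderiv_hermite[OF comm_ring_hom_const2])
    (simp_all only: mult_2, simp_all add: pderiv_diff pderiv_add pderiv_minus pderiv_pCons)

text \<open>The conjugation on a single power: the operator attached to \<open>GP a\<close>
  multiplies \<open>exp(xz + yz^2)\<close> by \<open>(xz)^a\<close>, and the right side is the
  coefficient of \<open>z^n / n!\<close> in the product.\<close>

lemma lin_ext_cop_GP:
  "lin_ext (cop n) (GP a) = smult [:ff a n:] (xP ^ a * Hpoly (n - int a))"
proof (induction a arbitrary: n)
  case 0
  have "(1 :: complex poly poly) = monom (monom 1 0) 0" by (simp add: monom_0)
  then have "lin_ext (cop n) 1 = smult [:1:] (cop n 0 0)"
    using lin_ext_monom by metis
  also have "\<dots> = Hpoly n" by (simp add: cop_def)
  finally show ?case by (simp add: hermite_0 comm_ring_hom_const2)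
next
  case (Suc a)
  \<comment> \<open>The lower Hermite term is written as a derivative, so that
    \<open>lin_ext_pderiv\<close> applies and the terms with \<open>y\<close> cancel against
    \<open>cop_Suc_left\<close>.\<close>
  have G: "GP (Suc a) = xP * GP a - 2 * (yP * GP a) - 2 * (yP * pderiv (GP a))"
    unfolding hermite_Suc[OF comm_ring_hom_const2] pderiv_GP
    by (simp add: algebra_simps del: mult_pCons_left mult_pCons_right minus_pCons)
  have "lin_ext (cop n) (GP (Suc a)) = lin_ext (cop n) (xP * GP a) - 2 * lin_ext (cop n) (yP * GP a) -
      2 * lin_ext (cop n) (yP * pderiv (GP a))"
    unfolding G by (simp only: lin_ext_diff lin_ext_add mult_2)
  also have "\<dots> = lin_ext (\<lambda>i j. smult [:of_int n:] (xP * cop (n - 1) i j)) (GP a)"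
    unfolding lin_ext_xP lin_ext_yP lin_ext_pderiv cop_Suc_left lin_ext_add_fun lin_ext_mult
    by (simp only: add.assoc diff_diff_eq add_diff_cancel)
  also have "\<dots> = [:[:of_int n:]:] * xP * lin_ext (cop (n - 1)) (GP a)"
    unfolding smult_const2 mult.assoc[symmetric] lin_ext_mult ..
  also have "\<dots> = smult [:ff (Suc a) n:] (xP ^ Suc a * Hpoly (n - int (Suc a)))"
    unfolding Suc smult_const2 ff_Suc' const2.hom_mult
    by (simp add: algebra_simps del: mult_pCons_left mult_pCons_right)
  finally show ?case .
qed

lemma lin_ext_cop_yP_power:
  "lin_ext (cop n) (yP ^ b * p) = smult [:ff (2 * b) n:] (yP ^ b * lin_ext (cop (n - 2 * int b)) p)"
proof (induction b arbitrary: n)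
  case (Suc b)
  have "lin_ext (cop n) (yP ^ Suc b * p) = lin_ext (\<lambda>i j. [:[:ff 2 n:]:] * yP * cop (n - 2) i j) (yP ^ b * p)"
    unfolding power_Suc mult.assoc lin_ext_yP cop_Suc_right smult_const2 ..
  also have "\<dots> = [:[:ff 2 n * ff (2 * b) (n - 2):]:] * (yP ^ Suc b * lin_ext (cop (n - 2 - 2 * int b)) p)"
    unfolding lin_ext_mult Suc smult_const2
    by (simp add: const2.hom_mult mult_ac del: mult_pCons_left mult_pCons_right)
  also have "ff 2 n * ff (2 * b) (n - 2) = ff (2 * Suc b) n"
    using ff_add[of 2 "2 * b" n] by simp
  finally show ?case by (simp add: algebra_simps)
qed simp

text \<open>The passage from \<open>Phi\<close> to \<open>Kpoly\<close> at \<open>z = 1\<close>: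
  powers of \<open>y\<close> stay and \<open>x^a\<close> becomes \<open>GP a\<close>.\<close>

definition yGP :: "complex poly poly \<Rightarrow> complex poly poly" where
  "yGP = lin_ext (\<lambda>a b. yP ^ b * GP a)"

lemma lin_ext_cop_yGP:
  "lin_ext (cop n) (yGP p) =
     lin_ext (\<lambda>a b. [:[:ff (a + 2 * b) n:]:] * Hpoly (n - int (a + 2 * b)) * (xP ^ a * yP ^ b)) p"
  unfolding yGP_def lin_ext_lin_ext
proof (rule lin_ext_cong)
  fix a b
  have "ff (a + 2 * b) n = ff (2 * b) n * ff a (n - 2 * int b)"
    using ff_add[of "2 * b" a n] by (simp add: add.commute)
  moreover have "n - 2 * int b - int a = n - int (a + 2 * b)"
    by simp
  ultimately show "lin_ext (cop n) (yP ^ b * GP a) =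
    [:[:ff (a + 2 * b) n:]:] * Hpoly (n - int (a + 2 * b)) * (xP ^ a * yP ^ b)"
    unfolding lin_ext_cop_yP_power lin_ext_cop_GP smult_const2
    by (simp only: const2.hom_mult mult_ac)
qed

text \<open>All monomials of \<open>p\<close> have \<open>a + 2 * b = w\<close>, hence share one
  falling factorial and one Hermite index, which come out of the sum.\<close>

lemma lin_ext_cop_yGP_homogeneous:
  assumes "wbound 1 2 (int w) p" "wbound (- 1) (- 2) (- int w) p"
  shows "lin_ext (cop n) (yGP p) = smult [:ff w n:] (Hpoly (n - int w) * p)"
proof -
  have "a + 2 * b = w" if "coeff (coeff p a) b \<noteq> 0" for a b
    using assms that unfolding wbound_def by force
  then have "lin_ext (cop n) (yGP p) =
      lin_ext (\<lambda>a b. [:[:ff w n:]:] * Hpoly (n - int w) * (xP ^ a * yP ^ b)) p"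
    unfolding lin_ext_cop_yGP by (intro lin_ext_cong) metis
  then show ?thesis
    unfolding lin_ext_mult lin_ext_id by (simp add: mult.assoc)
qed

section \<open>Determinants\<close>

lemma det_mat_scale:
  fixes f :: "nat \<Rightarrow> nat \<Rightarrow> 'a :: comm_ring_1"
  shows "det (mat n n (\<lambda>(i, j). u i * v j * f i j)) =
    prod u {..<n} * prod v {..<n} * det (mat n n (\<lambda>(i, j). f i j))"
proof -
  have entry: "(\<Prod>i<n. mat n n (\<lambda>(i, j). g i j) $$ (i, p i)) = (\<Prod>i<n. g i (p i))"
    if "p permutes {..<n}" for p and g :: "nat \<Rightarrow> nat \<Rightarrow> 'a"
    by (rule prod.cong) (use permutes_in_image[OF that] in auto)
  show ?thesis
    unfolding det_def'[OF mat_carrier] sum_distrib_left atLeast0LessThan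
  proof (rule sum.cong)
    fix p assume "p \<in> {p. p permutes {..<n}}"
    then have p: "p permutes {..<n}" by simp
    show "signof p * (\<Prod>i<n. mat n n (\<lambda>(i, j). u i * v j * f i j) $$ (i, p i)) =
        prod u {..<n} * prod v {..<n} * (signof p * (\<Prod>i<n. mat n n (\<lambda>(i, j). f i j) $$ (i, p i)))"
      unfolding entry[OF p] using prod.permute[OF p, of v] by (simp add: prod.distrib)
  qed simp
qed

text \<open>Rows and columns are reversed by the same permutation, whose sign enters twice.\<close>

lemma det_mat_reverse:
  fixes f :: "nat \<Rightarrow> nat \<Rightarrow> 'a :: comm_ring_1"
  shows "det (mat n n (\<lambda>(i, j). f (n - Suc i) (n - Suc j))) = det (mat n n (\<lambda>(i, j). f i j))"
proof -
  define p where "p = (\<lambda>i. if i < n then n - Suc i else i)"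
  have p: "p permutes {0..<n}"
    by (rule bij_imp_permutes, rule bij_betw_byWitness[where f' = p]) (auto simp: p_def)
  have s: "signof p * signof p = (1 :: 'a)"
    by (simp add: sign_def)
  have rows: "det (mat n n (\<lambda>(i, j). g (n - Suc i) j)) = signof p * det (mat n n (\<lambda>(i, j). g i j))"
    for g :: "nat \<Rightarrow> nat \<Rightarrow> 'a"
  proof -
    have "mat n n (\<lambda>(i, j). g (n - Suc i) j) = mat n n (\<lambda>(i, j). mat n n (\<lambda>(i, j). g i j) $$ (p i, j))"
      by (rule eq_matI) (auto simp: p_def)
    then show ?thesis
      by (simp only: det_permute_rows[OF mat_carrier p])
  qed
  have tr: "det (mat n n (\<lambda>(i, j). g i j)) = det (mat n n (\<lambda>(i, j). g j i))"
    for g :: "nat \<Rightarrow> nat \<Rightarrow> 'a"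
  proof -
    have "mat n n (\<lambda>(i, j). g j i) = transpose_mat (mat n n (\<lambda>(i, j). g i j))"
      by (rule eq_matI) auto
    then show ?thesis by (simp only: det_transpose[OF mat_carrier])
  qed
  have "det (mat n n (\<lambda>(i, j). f (n - Suc i) (n - Suc j))) =
      signof p * det (mat n n (\<lambda>(i, j). f i (n - Suc j)))"
    by (rule rows[of "\<lambda>i j. f i (n - Suc j)"])
  also have "det (mat n n (\<lambda>(i, j). f i (n - Suc j))) = det (mat n n (\<lambda>(i, j). f j (n - Suc i)))"
    by (rule tr)
  also have "\<dots> = signof p * det (mat n n (\<lambda>(i, j). f j i))"
    by (rule rows[of "\<lambda>i j. f j i"])
  also have "det (mat n n (\<lambda>(i, j). f j i)) = det (mat n n (\<lambda>(i, j). f i j))"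
    by (rule tr)
  finally show ?thesis
    using s by (simp flip: mult.assoc)
qed

text \<open>Subtracting from each row the next one turns the last column of ones into 0, ..., 0, 1;
  expansion along it before and after gives the two sides.\<close>

lemma det_mat_difference:
  fixes f :: "nat \<Rightarrow> nat \<Rightarrow> 'a :: comm_ring_1"
  shows "det (mat l l (\<lambda>(r, c). f r c - f (Suc r) c)) =
    (\<Sum>r<Suc l. cofactor (mat (Suc l) (Suc l) (\<lambda>(r, c). if c < l then f r c else 1)) r l)"
proof -
  define A where "A = mat (Suc l) (Suc l) (\<lambda>(r, c). if c < l then f r c else 1)"
  \<comment> \<open>Left multiplication by this unitriangular matrix performs the row
    subtractions.\<close>
  define U :: "'a mat" where
    "U = mat (Suc l) (Suc l) (\<lambda>(r, k). if k = r then 1 else if k = Suc r then - 1 else 0)"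
  have [simp]: "A \<in> carrier_mat (Suc l) (Suc l)" "U \<in> carrier_mat (Suc l) (Suc l)"
    by (simp_all add: A_def U_def)
  have "det U = 1"
  proof -
    have "det U = prod_list (diag_mat U)"
      by (rule det_upper_triangular[of _ "Suc l"]) (auto simp: U_def)
    also have "\<dots> = (\<Prod>i = 0..<Suc l. U $$ (i, i))"
      by (simp add: prod_list_diag_prod U_def)
    also have "\<dots> = 1"
      by (rule prod.neutral) (simp add: U_def)
    finally show ?thesis .
  qed
  have UA: "(U * A) $$ (r, c) = A $$ (r, c) - (if r < l then A $$ (Suc r, c) else 0)"
    if "r < Suc l" "c < Suc l" for r c
  proof -
    have "(U * A) $$ (r, c) = (\<Sum>k = 0..<Suc l. U $$ (r, k) * A $$ (k, c))"
      using that by (simp add: U_def A_def scalar_prod_def)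
    also have "\<dots> = (\<Sum>k = 0..<Suc l. (if k = r then A $$ (k, c) else 0) -
        (if k = Suc r then A $$ (k, c) else 0))"
      by (rule sum.cong) (use that in \<open>auto simp: U_def\<close>)
    also have "\<dots> = A $$ (r, c) - (if r < l then A $$ (Suc r, c) else 0)"
      using that by (auto simp: sum_subtractf sum.delta less_Suc_eq)
    finally show ?thesis .
  qed
  have "(\<Sum>r<Suc l. cofactor A r l) = (\<Sum>r<Suc l. A $$ (r, l) * cofactor A r l)"
    by (rule sum.cong) (auto simp: A_def)
  also have "\<dots> = det A"
    by (rule laplace_expansion_column[symmetric]) auto
  also have "\<dots> = det (U * A)"
    by (subst det_mult[of _ "Suc l"]) (simp_all add: \<open>det U = 1\<close>)
  also have "\<dots> = (\<Sum>r<Suc l. (U * A) $$ (r, l) * cofactor (U * A) r l)"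
    by (rule laplace_expansion_column) (auto intro!: mult_carrier_mat[of U "Suc l" "Suc l"])
  also have "\<dots> = (\<Sum>r<Suc l. if r = l then cofactor (U * A) l l else 0)"
  proof (rule sum.cong)
    fix r assume "r \<in> {..<Suc l}"
    then have "(U * A) $$ (r, l) = (if r = l then 1 else 0)"
      by (auto simp: UA) (auto simp: A_def)
    then show "(U * A) $$ (r, l) * cofactor (U * A) r l = (if r = l then cofactor (U * A) l l else 0)"
      by simp
  qed simp
  also have "\<dots> = det (mat_delete (U * A) l l)"
    by (simp add: cofactor_def)
  also have "mat_delete (U * A) l l = mat l l (\<lambda>(r, c). f r c - f (Suc r) c)"
  proof -
    have "dim_row (U * A) = Suc l" "dim_col (U * A) = Suc l"
      by (simp_all add: U_def A_def)
    then show ?thesis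
      by (intro eq_matI) (auto simp: mat_delete_def UA simp del: index_mult_mat(1), auto simp: A_def)
  qed
  finally show ?thesis by (simp add: A_def)
qed

section \<open>The Vandermonde determinant in falling factorials\<close>

lemma poly_eq_0_nodes:
  fixes q :: "complex poly"
  assumes "\<And>i. l \<le> i \<Longrightarrow> coeff q i = 0" and "\<And>c. c < l \<Longrightarrow> poly q (z c) = 0"
    and "inj_on z {..<l}"
  shows "q = 0"
proof (rule ccontr)
  assume "q \<noteq> 0"
  then have "degree q < l"
    using assms(1) by (metis leading_coeff_0_iff not_le_imp_less)
  moreover have "l \<le> card {x. poly q x = 0}"
  proof -
    have "card (z ` {..<l}) \<le> card {x. poly q x = 0}"
      by (rule card_mono) (use assms(2) \<open>q \<noteq> 0\<close> in \<open>auto intro: poly_roots_finite\<close>)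
    then show ?thesis using card_image[OF assms(3)] by simp
  qed
  ultimately show False
    using card_poly_roots_bound[OF \<open>q \<noteq> 0\<close>] by simp
qed

lemma ffact_poly_monic: "degree (ffact_poly k) = k" "lead_coeff (ffact_poly k) = 1"
proof -
  have "lead_coeff (ffact_poly k) = 1"
    unfolding ffact_poly_def lead_coeff_prod by simp
  moreover have "degree (ffact_poly k) = k"
    unfolding ffact_poly_def by (subst degree_prod_eq_sum_degree) auto
  ultimately show "degree (ffact_poly k) = k" "lead_coeff (ffact_poly k) = 1" by auto
qed

lemma coeff_ffact_poly: "k \<le> i \<Longrightarrow> coeff (ffact_poly k) i = (if i = k then 1 else 0)"
  using ffact_poly_monic[of k] by (auto intro: coeff_eq_0)

text \<open>As a polynomial in the last node, the determinant has the other nodes as zeros and the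
  next smaller determinant as leading coefficient.\<close>

lemma det_ff:
  assumes "inj_on x {..<l}"
  shows "det (mat l l (\<lambda>(r, c). ff r (x c))) = (\<Prod>c'<l. \<Prod>c<c'. of_int (x c' - x c))"
  using assms
proof (induction l)
  case (Suc l)
  define A where "A = mat (Suc l) (Suc l) (\<lambda>(r, c). ff r (x c))"
  \<comment> \<open>The expansion of the determinant along the last column, with the last node
    replaced by an indeterminate.\<close>
  define P where "P = (\<Sum>r<Suc l. smult (cofactor A r l) (ffact_poly r))"
  have carr: "A \<in> carrier_mat (Suc l) (Suc l)" by (simp add: A_def)
  have cof: "cofactor A l l = det (mat l l (\<lambda>(r, c). ff r (x c)))"
    unfolding cofactor_def mat_delete_def
    by (simp add: A_def) (auto intro!: arg_cong[of _ _ det] eq_matI)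
  have P: "poly P (of_int (x c)) = (if c = l then det A else 0)" if "c \<le> l" for c
  proof -
    \<comment> \<open>Evaluating \<open>P\<close> at node \<open>c\<close> puts this node into the
      last column; for \<open>c < l\<close> two columns then coincide.\<close>
    define B where "B = mat (Suc l) (Suc l) (\<lambda>(r, j). ff r (x (if j = l then c else j)))"
    have B: "B \<in> carrier_mat (Suc l) (Suc l)" by (simp add: B_def)
    have "poly P (of_int (x c)) = (\<Sum>r<Suc l. B $$ (r, l) * cofactor B r l)"
      unfolding P_def poly_sum
    proof (rule sum.cong)
      fix r assume "r \<in> {..<Suc l}"
      moreover have "cofactor A r l = cofactor B r l"
        unfolding cofactor_def mat_delete_def
        by (auto simp: A_def B_def intro!: arg_cong[of _ _ det] eq_matI)
      ultimately show "poly (smult (cofactor A r l) (ffact_poly r)) (of_int (x c)) =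
          B $$ (r, l) * cofactor B r l"
        by (simp add: B_def ff_def)
    qed simp
    also have "\<dots> = det B"
      by (rule laplace_expansion_column[OF B, symmetric]) simp
    also have "det B = (if c = l then det A else 0)"
    proof (cases "c = l")
      case True
      then have "B = A" by (auto simp: A_def B_def intro!: eq_matI)
      then show ?thesis using True by simp
    next
      case False
      then have "det B = 0"
        using that by (intro det_identical_columns[OF B, of c l]) (auto simp: B_def col_def intro!: eq_vecI)
      then show ?thesis using False by simp
    qed
    finally show ?thesis .
  qed
  have "P = smult (cofactor A l l) (\<Prod>c<l. [:- of_int (x c), 1:])"
  proof -
    define R where "R = (\<Prod>c<l. [:- complex_of_int (x c), 1:])"
    have R: "degree R = l" "lead_coeff R = 1"
    proof -
      show "lead_coeff R = 1" unfolding R_def lead_coeff_prod by simp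
      show "degree R = l" unfolding R_def by (subst degree_prod_eq_sum_degree) auto
    qed
    \<comment> \<open>Both polynomials have the same coefficient at \<open>l\<close> and none
      beyond, so the difference has degree below \<open>l\<close> and vanishes at \<open>l\<close>
      distinct nodes.\<close>
    have "P - smult (cofactor A l l) R = 0"
    proof (rule poly_eq_0_nodes[where l = l and z = "\<lambda>c. of_int (x c)"])
      fix i assume i: "l \<le> i"
      have "coeff P i = (\<Sum>r<Suc l. if r = l then (if i = l then cofactor A l l else 0) else 0)"
        unfolding P_def coeff_sum
        by (rule sum.cong) (use i in \<open>auto simp: coeff_ffact_poly\<close>)
      also have "\<dots> = (if i = l then cofactor A l l else 0)" by simp
      finally show "coeff (P - smult (cofactor A l l) R) i = 0"
        using R i by (auto intro: coeff_eq_0)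
    next
      fix c assume "c < l"
      then have "poly R (of_int (x c)) = 0" by (auto simp: R_def poly_prod)
      then show "poly (P - smult (cofactor A l l) R) (of_int (x c)) = 0"
        using P[of c] \<open>c < l\<close> by simp
    next
      show "inj_on (\<lambda>c. complex_of_int (x c)) {..<l}"
        using Suc.prems by (auto simp: inj_on_def)
    qed
    then show ?thesis by (simp add: R_def)
  qed
  then have "det A = cofactor A l l * (\<Prod>c<l. of_int (x l - x c))"
    using P[of l] by (simp add: poly_prod)
  moreover have "inj_on x {..<l}"
    using Suc.prems by (auto simp: inj_on_def)
  ultimately have "det A = (\<Prod>c'<Suc l. \<Prod>c<c'. of_int (x c' - x c))"
    using Suc.IH unfolding cof by simp
  then show ?case unfolding A_def .
qed simp

section \<open>Homogenization\<close>

lemma comm_ring_homI: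
  fixes f :: "'a :: comm_ring_1 \<Rightarrow> 'b :: comm_ring_1"
  assumes "f 1 = 1" "\<And>x y. f (x + y) = f x + f y" "\<And>x y. f (x * y) = f x * f y"
  shows "comm_ring_hom f"
proof -
  have "f 0 = 0" using assms(2)[of 0 0] by simp
  then show ?thesis by unfold_locales (simp_all add: assms)
qed

lemma comm_ring_hom_fls_const: "comm_ring_hom (\<lambda>a :: complex. fls_const [:a:])"
  by (rule comm_ring_homI) (simp_all add: one_pCons[symmetric] fls_plus_const mult.commute)

lemma comm_ring_hom_comp:
  assumes "comm_ring_hom f" "comm_ring_hom g"
  shows "comm_ring_hom (\<lambda>x. f (g x))"
proof -
  interpret f: comm_ring_hom f by fact
  interpret g: comm_ring_hom g by fact
  show ?thesis by (rule comm_ring_homI) (simp_all add: hom_distribs)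
qed

lemma comm_ring_hom_pCons: "comm_ring_hom (\<lambda>a :: 'a :: comm_ring_1. [:a:])"
  by (rule comm_ring_homI) (simp_all add: one_pCons mult.commute)

lemma comm_ring_hom_poly_map_poly:
  assumes "comm_ring_hom f"
  shows "comm_ring_hom (\<lambda>p. poly (map_poly f p) a)"
proof -
  interpret comm_ring_hom f by fact
  have add: "map_poly f (p + q) = map_poly f p + map_poly f q" for p q
    by (rule poly_eqI) (simp add: coeff_map_poly hom_add)
  have smult: "map_poly f (smult c p) = smult (f c) (map_poly f p)" for c p
    by (rule poly_eqI) (simp add: coeff_map_poly hom_mult)
  have mult: "poly (map_poly f (p * q)) a = poly (map_poly f p) a * poly (map_poly f q) a" for p q
    by (induction p) (simp_all add: add smult map_poly_pCons algebra_simps)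
  show ?thesis
    by (rule comm_ring_homI) (simp_all add: add mult map_poly_pCons one_pCons)
qed

text \<open>The inner stage of \<open>thetaA\<close>: the substitution of \<open>y z^2\<close> for
  \<open>y\<close> in the coefficients.\<close>

definition psiA :: "complex poly \<Rightarrow> complex poly fls" where
  "psiA q = poly (map_poly (\<lambda>a. fls_const [:a:]) q) (fls_const [:0, 1:] * fls_X ^ 2)"

text \<open>The substitution \<open>x \<mapsto> x z\<close>, \<open>y \<mapsto> y z\<^sup>2\<close>; it turns a polynomial into one that is homogeneous
  of weight 0, with \<open>x\<close>, \<open>y\<close>, \<open>z\<close> of weights 1, 2, -1.\<close>

definition thetaA :: "complex poly poly \<Rightarrow> complex poly fls poly" where
  "thetaA p = poly (map_poly (\<lambda>q. [:psiA q:]) p) (xA * zA)"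

interpretation psiA: comm_ring_hom psiA
  unfolding psiA_def
  by (intro comm_ring_hom_poly_map_poly comm_ring_hom_fls_const)

interpretation thetaA: comm_ring_hom thetaA
  unfolding thetaA_def
  by (intro comm_ring_hom_poly_map_poly
    comm_ring_hom_comp[OF comm_ring_hom_pCons] psiA.comm_ring_hom_axioms)

lemma psiA_pCons: "psiA (pCons a q) = fls_const [:a:] + fls_const [:0, 1:] * (fls_X ^ 2 * psiA q)"
proof -
  interpret c: comm_ring_hom "\<lambda>a :: complex. fls_const [:a:]"
    by (rule comm_ring_hom_fls_const)
  show ?thesis
    using c.hom_zero by (simp add: psiA_def map_poly_pCons mult.assoc)
qed

lemma thetaA_pCons: "thetaA (pCons q p) = [:psiA q:] + xA * zA * thetaA p"
proof -
  have "psiA 0 = 0" by simp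
  then show ?thesis by (simp add: thetaA_def map_poly_pCons)
qed

lemma fls_X_power_times_nth:
  "fls_nth (fls_X ^ n * f) k = fls_nth (f :: 'a :: comm_ring_1 fls) (k - int n)"
proof (induction n arbitrary: k)
  case (Suc n)
  have "fls_nth (fls_X ^ Suc n * f) k = fls_nth (fls_X * (fls_X ^ n * f)) k"
    by (simp add: mult.assoc)
  also have "\<dots> = fls_nth (fls_X ^ n * f) (k - 1)"
    by (simp only: fls_X_times_conv_shift(1) fls_shift_nth) simp
  finally show ?case by (simp add: Suc.IH diff_diff_eq)
qed simp

text \<open>Each \<open>y\<close> carries \<open>z^2\<close>, so the coefficients of
  \<open>q\<close> are recovered from the matching powers of \<open>z\<close>.\<close>

lemma psiA_nth: "coeff (fls_nth (psiA q) (2 * int j)) j = coeff q j"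
proof (induction q arbitrary: j)
  case (pCons a q)
  show ?case
  proof (cases j)
    case 0
    then show ?thesis by (simp add: psiA_pCons)
  next
    case (Suc k)
    then have "fls_nth (fls_X ^ 2 * psiA q) (2 * int j) = fls_nth (psiA q) (2 * int k)"
      by (simp only: fls_X_power_times_nth) simp
    then show ?thesis
      using pCons.IH[of k] Suc by (simp add: psiA_pCons)
  qed
qed simp

lemma coeff_thetaA: "coeff (thetaA p) i = fls_X ^ i * psiA (coeff p i)"
proof (induction p arbitrary: i)
  case (pCons q p)
  then show ?case
    by (cases i) (simp_all add: thetaA_pCons xA_def zA_def mult.assoc)
qed simp

lemma thetaA_const: "thetaA [:q:] = [:psiA q:]"
  by (simp add: thetaA_pCons)

lemma thetaA_const2: "thetaA [:[:a:]:] = cA a"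
  by (simp add: thetaA_const psiA_pCons cA_def)

lemma thetaA_xP: "thetaA xP = zA * xA"
  by (simp add: thetaA_pCons mult.commute one_pCons[symmetric])

lemma thetaA_yP: "thetaA yP = zA ^ 2 * yA"
proof -
  have "psiA [:0, 1:] = fls_X ^ 2 * fls_const [:0, 1:]"
    by (simp add: psiA_pCons one_pCons[symmetric] mult.commute)
  then show ?thesis
    by (simp add: thetaA_const zA_def yA_def power2_eq_square)
qed

lemma comm_ring_hom_cA: "comm_ring_hom cA"
  unfolding cA_def
  by (rule comm_ring_hom_comp[OF comm_ring_hom_pCons comm_ring_hom_fls_const])

lemma zA_zinvA: "zA * zinvA = 1"
  by (simp add: zA_def zinvA_def fls_X_inv_times_conv_shift one_pCons)

lemma zA_neq_0: "zA \<noteq> 0"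
  by (simp add: zA_def)

section \<open>Homogenized Hermite and Bell polynomials\<close>

lemma thetaA_Hpoly: "thetaA (Hpoly (int n)) = zA ^ n * hermite cA (int n) xA yA"
  unfolding Hpoly_def
  by (rule hermite_hom_scaled[OF comm_ring_hom_const2 comm_ring_hom_cA thetaA.comm_ring_hom_axioms])
    (simp_all add: thetaA_xP thetaA_yP)

lemma thetaA_GP: "thetaA (GP n) = zA ^ n * hermite cA (int n) (xA - 2 * yA * zA) (- yA)"
  by (rule hermite_hom_scaled[OF comm_ring_hom_const2 comm_ring_hom_cA thetaA.comm_ring_hom_axioms])
    (simp_all only: hom_distribs thetaA_xP thetaA_yP, simp_all add: power2_eq_square algebra_simps)

text \<open>The Miwa shift of the arguments multiplies the generating function of the \<open>bell\<close> polynomials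
  by \<open>1 - w / z\<close>, where \<open>w\<close> is its variable.\<close>

lemma bell_shift:
  "bell cA k (\<lambda>k. (if k = 1 then xA else if k = 2 then yA else 0) - cA (1 / of_nat k) * zinvA ^ k) =
     cA (1 / fact (nat k)) * hermite cA k xA yA -
     zinvA * (cA (1 / fact (nat (k - 1))) * hermite cA (k - 1) xA yA)"
proof (cases "k < 0")
  case False
  define t where "t = (\<lambda>k. (if k = 1 then xA else if k = 2 then yA else 0) - cA (1 / of_nat k) * zinvA ^ k)"
  define g where "g = Abs_fps (\<lambda>i. if i = 0 then 0 else t i)"
  define h where "h = fps_const xA * fps_X + fps_const yA * fps_X ^ 2"
  define E where "E = alg_exp cA h"
  define Z where "Z = 1 - fps_const zinvA * fps_X"
  \<comment> \<open>\<open>Q\<close> is the derivative of \<open>-log(1 - w/z)\<close>, the sum of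
    the shifts; as a geometric series it is \<open>fps_const zinvA\<close> divided by
    \<open>Z\<close>.\<close>
  define Q where "Q = Abs_fps (\<lambda>n. zinvA ^ Suc n)"
  have h': "fps_nth (fps_deriv h) n = (if n = 0 then xA else if n = 1 then 2 * yA else 0)" for n
  proof -
    have "fps_deriv h = fps_const xA + fps_const (2 * yA) * fps_X"
      by (simp add: h_def power2_eq_square mult_2 algebra_simps flip: fps_const_add)
    then show ?thesis by (auto simp del: fps_const_mult)
  qed
  have g': "fps_deriv g = fps_deriv h - Q"
  proof (rule fps_ext)
    fix n
    have c: "of_nat (Suc n) * cA (1 / of_nat (Suc n)) = 1"
      using hom_inverse_of_nat[OF comm_ring_hom_cA, of n] by (simp only: mult.commute)
    have "fps_nth (fps_deriv g) n =
        of_nat (Suc n) * (if Suc n = 1 then xA else if Suc n = 2 then yA else 0) -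
        of_nat (Suc n) * cA (1 / of_nat (Suc n)) * zinvA ^ Suc n"
      by (simp add: g_def t_def algebra_simps del: of_nat_Suc power_Suc)
    also have "\<dots> = (if n = 0 then xA else if n = 1 then 2 * yA else 0) - zinvA ^ Suc n"
      unfolding c by auto
    also have "\<dots> = fps_nth (fps_deriv h - Q) n"
      by (simp only: fps_sub_nth h' Q_def fps_nth_Abs_fps)
    finally show "fps_nth (fps_deriv g) n = fps_nth (fps_deriv h - Q) n" .
  qed
  have ZQ: "Z * Q = fps_const zinvA"
    unfolding Z_def
    by (rule fps_ext) (auto simp: Q_def left_diff_distrib mult.assoc simp flip: power_Suc)
  have h0: "fps_nth h 0 = 0" by (simp add: h_def)
  \<comment> \<open>The product solves the differential equation of \<open>alg_exp cA g\<close>: the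
    derivative of \<open>Z\<close> contributes the summand \<open>- Q\<close> of
    \<open>fps_deriv g\<close>.\<close>
  have "Z * E = alg_exp cA g"
  proof (rule alg_exp_unique[OF comm_ring_hom_cA])
    show "fps_nth g 0 = 0" by (simp add: g_def)
    show "fps_nth (Z * E) 0 = 1"
      by (simp add: Z_def E_def alg_exp_nth_0[OF comm_ring_hom_cA])
    have "fps_deriv (Z * E) = Z * E * fps_deriv h - fps_const zinvA * E"
      by (simp add: Z_def E_def alg_exp_deriv[OF comm_ring_hom_cA h0] algebra_simps)
    also have "\<dots> = Z * E * fps_deriv g"
      unfolding g' ZQ[symmetric] by (simp add: algebra_simps)
    finally show "fps_deriv (Z * E) = Z * E * fps_deriv g" .
  qed
  then have "bell cA k t = fps_nth (Z * E) (nat k)"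
    using False by (simp add: bell_def g_def)
  also have "\<dots> = fps_nth E (nat k) - zinvA * (if nat k = 0 then 0 else fps_nth E (nat k - 1))"
    by (simp add: Z_def left_diff_distrib mult.assoc)
  also have "(if nat k = 0 then 0 else fps_nth E (nat k - 1)) =
      cA (1 / fact (nat (k - 1))) * hermite cA (k - 1) xA yA"
    using False by (auto simp: E_def h_def alg_exp_nth_hermite[OF comm_ring_hom_cA] nat_diff_distrib of_nat_diff)
  also have "fps_nth E (nat k) = cA (1 / fact (nat k)) * hermite cA k xA yA"
    using False by (simp add: E_def h_def alg_exp_nth_hermite[OF comm_ring_hom_cA])
  finally show ?thesis unfolding t_def .
qed (simp add: bell_def)

text \<open>This is \<open>B_k(x, y, 0, ...)\<close>. For negative \<open>k\<close> it is 0 since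
  \<open>Hpoly k\<close> is, whatever the value of \<open>nat k\<close>.\<close>

definition hP :: "int \<Rightarrow> complex poly poly" where
  "hP k = smult [:1 / fact (nat k):] (Hpoly k)"

text \<open>The shifted Bell polynomial is homogeneous of weight \<open>n\<close>, with
  \<open>z\<close> of weight -1, so \<open>z^n\<close> times it is recovered by
  \<open>thetaA\<close> from its value at \<open>z = 1\<close>.\<close>

lemma thetaA_bell:
  "zA ^ n * bell cA (int n)
      (\<lambda>k. (if k = 1 then xA else if k = 2 then yA else 0) - cA (1 / of_nat k) * zinvA ^ k) =
    thetaA (hP (int n) - hP (int n - 1))"
proof -
  have hP: "thetaA (hP (int n)) = zA ^ n * (cA (1 / fact n) * hermite cA (int n) xA yA)" for n
    by (simp only: hP_def smult_const2 thetaA.hom_mult thetaA_const2 thetaA_Hpoly nat_int mult_ac)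
  show ?thesis
  proof (cases n)
    case 0
    then show ?thesis using hP[of 0]
      unfolding bell_shift thetaA.hom_minus by (simp add: hP_def)
  next
    case (Suc m)
    have "zA ^ n * (zinvA * c) = zA ^ m * c" for c
    proof -
      have "zA ^ n * (zinvA * c) = zA ^ m * (zA * zinvA) * c" by (simp add: Suc mult_ac)
      then show ?thesis by (simp only: zA_zinvA mult_1_right)
    qed
    moreover have "int n - 1 = int m" using Suc by simp
    ultimately show ?thesis
      by (simp only: bell_shift thetaA.hom_minus right_diff_distrib nat_int hP)
  qed
qed

section \<open>Partitions and cofactors of the Wronskian\<close>

lemma hP_neg [simp]: "k < 0 \<Longrightarrow> hP k = 0"
  by (simp add: hP_def)

text \<open>After division by factorials derivatives become index shifts, which turns columns of a
  Wronskian into rows of a Schur determinant.\<close>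

lemma higher_pderiv_Hpoly_hP:
  assumes "0 \<le> k"
  shows "(pderiv ^^ r) (Hpoly k) = smult [:fact (nat k):] (hP (k - int r))"
proof (cases "int r \<le> k")
  case True
  then have "ff r k * fact (nat (k - int r)) = fact (nat k)"
    using ff_fact[of r "nat k"] assms by (simp add: nat_diff_distrib)
  then have "fact (nat k) * (1 / fact (nat (k - int r))) = ff r k"
    by (simp add: field_simps)
  then show ?thesis
    by (simp add: higher_pderiv_Hpoly hP_def)
qed (simp add: higher_pderiv_Hpoly)

lemma wbound_xP: "a \<le> w \<Longrightarrow> wbound a b w xP"
  by (auto simp: wbound_def coeff_pCons split: nat.splits)

lemma wbound_yP: "b \<le> w \<Longrightarrow> wbound a b w yP"
  by (auto simp: wbound_def coeff_pCons split: nat.splits)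

lemma wbound_Hpoly: "wbound 1 2 n (Hpoly n)" "wbound (- 1) (- 2) (- n) (Hpoly n)"
  using wbound_hermite[of 1 2 1 xP yP n] wbound_hermite[of "- 1" "- 2" "- 1" xP yP n]
  by (simp_all add: Hpoly_def wbound_xP wbound_yP)

lemma smult_inverse_cancel: "c \<noteq> 0 \<Longrightarrow> smult [:1 / c:] (smult [:c:] q) = (q :: complex poly poly)"
  by simp

locale partition =
  fixes lam :: "nat \<Rightarrow> nat"
  assumes partition: "is_partition lam"
begin

abbreviation "l \<equiv> part_len lam"
abbreviation "N \<equiv> part_size lam"

lemma lam_antimono: "1 \<le> i \<Longrightarrow> i \<le> j \<Longrightarrow> lam j \<le> lam i"
  by (rule dec_induct[of i j]) (use partition in \<open>auto simp: is_partition_def intro: order_trans\<close>)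

text \<open>By monotonicity the support is an initial segment of the positive integers, so its
  cardinality is its last element.\<close>

lemma part_support_eq: "part_support lam = {1..l}"
proof -
  let ?S = "part_support lam"
  have fin: "finite ?S" using partition by (simp add: is_partition_def)
  show ?thesis
  proof (cases "?S = {}")
    case False
    have "?S = {1..Max ?S}"
    proof
      show "?S \<subseteq> {1..Max ?S}" using fin by (auto simp: part_support_def)
      show "{1..Max ?S} \<subseteq> ?S"
      proof
        fix i assume i: "i \<in> {1..Max ?S}"
        have "Max ?S \<in> ?S" using fin False by simp
        then have "lam (Max ?S) \<noteq> 0" by (simp add: part_support_def)
        with lam_antimono[of i "Max ?S"] i show "i \<in> ?S" by (auto simp: part_support_def)
      qed
    qed
    then show ?thesis by (metis card_atLeastAtMost diff_Suc_1 part_len_def)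
  qed (simp add: part_len_def)
qed

lemma lam_pos:
  assumes "1 \<le> i" "i \<le> l"
  shows "1 \<le> lam i"
proof -
  have "i \<in> part_support lam" using assms by (simp add: part_support_eq)
  then show ?thesis by (simp add: part_support_def)
qed

lemma lam_0:
  assumes "l < i"
  shows "lam i = 0"
proof -
  have "i \<notin> part_support lam" using assms by (simp add: part_support_eq)
  then show ?thesis using assms by (simp add: part_support_def)
qed

lemma part_size_eq: "N = (\<Sum>i<l. lam (Suc i))"
proof -
  have "N = (\<Sum>i = Suc 0..l. lam i)" by (simp add: part_size_def part_support_eq)
  also have "\<dots> = (\<Sum>i = 0..<l. lam (Suc i))"
    by (metis atLeastLessThanSuc_atLeastAtMost sum.shift_bounds_Suc_ivl)
  finally show ?thesis by (simp add: atLeast0LessThan)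
qed

lemma part_len_le_size: "l \<le> N"
proof -
  have "(\<Sum>i<l. 1) \<le> N" unfolding part_size_eq by (rule sum_mono) (use lam_pos in simp)
  then show ?thesis by simp
qed

lemma pm_less: "1 \<le> i \<Longrightarrow> i < j \<Longrightarrow> pm lam j < pm lam i"
  using lam_antimono[of i j] by (simp add: pm_def)

lemma pm_inj: "inj_on (pm lam) {1..}"
  by (rule linorder_inj_onI) (use pm_less in force)+

text \<open>The indices of the Wronskian, in the order of its columns.\<close>

definition xs :: "nat \<Rightarrow> int" where
  "xs c = pk lam (l - c)"

lemma xs_eq: "c < l \<Longrightarrow> xs c = int (lam (l - c)) + int c"
  by (simp add: xs_def pk_def pm_def of_nat_diff)

lemma xs_nonneg: "c < l \<Longrightarrow> 0 \<le> xs c"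
  by (simp add: xs_eq)

lemma xs_inj: "inj_on xs {..<l}"
proof (rule inj_onI)
  fix c d assume "c \<in> {..<l}" "d \<in> {..<l}" "xs c = xs d"
  then have "l - c = l - d"
    by (intro inj_onD[OF pm_inj]) (auto simp: xs_def pk_def)
  with \<open>c \<in> {..<l}\<close> \<open>d \<in> {..<l}\<close> show "c = d" by auto
qed

lemma sum_xs: "(\<Sum>c<l. xs c) = int N + (\<Sum>c<l. int c)"
proof -
  have "(\<Sum>c<l. lam (l - c)) = (\<Sum>c<l. lam (Suc (l - Suc c)))"
    by (rule sum.cong) (auto simp: Suc_diff_Suc)
  also have "\<dots> = N"
    unfolding part_size_eq by (rule sum.nat_diff_reindex)
  finally have "(\<Sum>c<l. int (lam (l - c))) = int N"
    by (metis of_nat_sum)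
  moreover have "(\<Sum>c<l. xs c) = (\<Sum>c<l. int (lam (l - c)) + int c)"
    by (rule sum.cong) (auto simp: xs_eq)
  ultimately show ?thesis by (simp add: sum.distrib)
qed

lemma prod_xs: "(\<Prod>c<l. g (xs c)) = (\<Prod>i = 1..l. g (pk lam i))"
  by (rule prod.reindex_bij_witness[of _ "\<lambda>i. l - i" "\<lambda>c. l - c"]) (auto simp: xs_def)

lemma vander_eq: "vander lam = (\<Prod>c'<l. \<Prod>c<c'. of_int (xs c' - xs c))"
proof -
  have "(\<Prod>c'<l. \<Prod>c<c'. complex_of_int (xs c' - xs c)) =
      (\<Prod>(c', c)\<in>(SIGMA c':{..<l}. {..<c'}). of_int (xs c' - xs c))"
    by (subst prod.Sigma) auto
  also have "\<dots> = vander lam"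
    unfolding vander_def
    by (rule prod.reindex_bij_witness[of _ "\<lambda>(i, j). (l - i, l - j)" "\<lambda>(c', c). (l - c', l - c)"])
      (auto simp: xs_def)
  finally show ?thesis ..
qed

lemma vander_neq_0: "vander lam \<noteq> 0"
proof -
  have "xs c' \<noteq> xs c" if "c' < l" "c < c'" for c c'
    using inj_onD[OF xs_inj, of c' c] that by auto
  then show ?thesis by (auto simp: vander_eq)
qed

text \<open>The last column is arbitrary: the cofactors along it do not depend on it.\<close>

definition wcof :: "nat \<Rightarrow> complex poly poly" where
  "wcof r = cofactor (mat (Suc l) (Suc l)
     (\<lambda>(r, c). if c < l then (pderiv ^^ r) (Hpoly (xs c)) else 1)) r l"

text \<open>Laplace expansion along the last column. The same cofactors thus occur in the
  exceptional Wronskian and, for a last column of ones, in the Schur determinant.\<close>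

lemma det_border:
  "det (mat (Suc l) (Suc l) (\<lambda>(r, c). if c < l then (pderiv ^^ r) (Hpoly (xs c)) else g r)) =
     (\<Sum>r<Suc l. g r * wcof r)"
proof -
  define A where "A = mat (Suc l) (Suc l) (\<lambda>(r, c). if c < l then (pderiv ^^ r) (Hpoly (xs c)) else g r)"
  have "det A = (\<Sum>r<Suc l. A $$ (r, l) * cofactor A r l)"
    by (rule laplace_expansion_column) (auto simp: A_def)
  also have "\<dots> = (\<Sum>r<Suc l. g r * wcof r)"
  proof (rule sum.cong)
    fix r assume "r \<in> {..<Suc l}"
    moreover have "cofactor A r l = wcof r"
      unfolding cofactor_def wcof_def mat_delete_def
      by (auto simp: A_def intro!: arg_cong[of _ _ det] eq_matI)
    ultimately show "A $$ (r, l) * cofactor A r l = g r * wcof r"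
      by (simp add: A_def)
  qed simp
  finally show ?thesis by (simp only: A_def)
qed

lemma wronskian_eq:
  "wronskian (map (\<lambda>i. Hpoly (pk lam i)) (rev [1..<Suc l]) @ [Hpoly m]) =
     (\<Sum>r<Suc l. (pderiv ^^ r) (Hpoly m) * wcof r)"
proof -
  let ?fs = "map (\<lambda>i. Hpoly (pk lam i)) (rev [1..<Suc l]) @ [Hpoly m]"
  have len: "length ?fs = Suc l" by simp
  have nth: "?fs ! c = (if c < l then Hpoly (xs c) else Hpoly m)" if "c < Suc l" for c
  proof (cases "c < l")
    case True
    then have "rev [1..<Suc l] ! c = l - c"
      by (subst rev_nth) (simp_all add: nth_upt del: upt_Suc)
    with True show ?thesis by (simp add: nth_append xs_def del: upt_Suc)
  next
    case False
    then show ?thesis using that by (simp add: nth_append less_Suc_eq del: upt_Suc)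
  qed
  show ?thesis
    unfolding wronskian_def len det_border[symmetric]
    by (rule arg_cong[of _ _ det], rule eq_matI) (simp_all add: nth[unfolded One_nat_def] del: upt_Suc)
qed

text \<open>Reversed and transposed, the matrix has as its columns the differences of consecutive
  derivatives of \<open>Hpoly (xs c)\<close>, up to factorials; \<open>det_mat_difference\<close>
  then yields the cofactors.\<close>

lemma det_hP:
  "det (mat l l (\<lambda>(i, j). hP (int (lam (Suc i)) - int i + int j) - hP (int (lam (Suc i)) - int i + int j - 1))) =
     smult [:1 / (\<Prod>i = 1..l. fact (nat (pk lam i))):] (\<Sum>r<Suc l. wcof r)"
proof -
  define f where "f r c = hP (xs c - int r)" for r c
  let ?P = "\<Prod>i = 1..l. fact (nat (pk lam i)) :: complex"
  have "det (mat l l (\<lambda>(i, j). hP (int (lam (Suc i)) - int i + int j) - hP (int (lam (Suc i)) - int i + int j - 1))) =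
      det (mat l l (\<lambda>(i, j). f (l - Suc j) (l - Suc i) - f (Suc (l - Suc j)) (l - Suc i)))"
    by (rule arg_cong[of _ _ det], rule eq_matI)
      (auto simp: f_def xs_eq of_nat_diff algebra_simps Suc_diff_Suc)
  also have "\<dots> = det (mat l l (\<lambda>(i, j). f j i - f (Suc j) i))"
    by (rule det_mat_reverse[of l "\<lambda>i j. f j i - f (Suc j) i"])
  also have "\<dots> = det (mat l l (\<lambda>(r, c). f r c - f (Suc r) c))"
    by (subst det_transpose[symmetric, of _ l]) (auto intro!: arg_cong[of _ _ det] eq_matI)
  finally have 1: "det (mat l l (\<lambda>(i, j). hP (int (lam (Suc i)) - int i + int j) - hP (int (lam (Suc i)) - int i + int j - 1))) =
      det (mat l l (\<lambda>(r, c). f r c - f (Suc r) c))" .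
  \<comment> \<open>Column \<open>c\<close> is multiplied by the factorial of its index, which
    converts the shifted \<open>hP\<close> back into derivatives.\<close>
  have "(\<Prod>c<l. [:[:fact (nat (xs c)):]:]) * det (mat l l (\<lambda>(r, c). f r c - f (Suc r) c)) =
      det (mat l l (\<lambda>(r, c). 1 * [:[:fact (nat (xs c)):]:] * (f r c - f (Suc r) c)))"
    using det_mat_scale[of l "\<lambda>_. 1" "\<lambda>c. [:[:fact (nat (xs c)):]:]" "\<lambda>r c. f r c - f (Suc r) c"]
    by (simp only: prod.neutral_const mult_1_left)
  also have "\<dots> = det (mat l l (\<lambda>(r, c). (pderiv ^^ r) (Hpoly (xs c)) - (pderiv ^^ Suc r) (Hpoly (xs c))))"
    by (rule arg_cong[of _ _ det], rule eq_matI)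
      (auto simp: higher_pderiv_Hpoly_hP xs_nonneg f_def smult_diff_right simp del: funpow.simps)
  also have "\<dots> = (\<Sum>r<Suc l. wcof r)"
    unfolding wcof_def by (rule det_mat_difference)
  also have "(\<Prod>c<l. [:[:fact (nat (xs c)):]:]) = [:[:?P:]:]"
    by (simp only: prod_xs[of "\<lambda>k. fact (nat k)", symmetric] const2.hom_prod)
  finally have 2: "smult [:?P:] (det (mat l l (\<lambda>(r, c). f r c - f (Suc r) c))) = (\<Sum>r<Suc l. wcof r)"
    by (simp only: smult_const2)
  have "?P \<noteq> 0" by simp
  from smult_inverse_cancel[OF this, of "det (mat l l (\<lambda>(r, c). f r c - f (Suc r) c))"] show ?thesis
    unfolding 1 2 ..
qed

text \<open>The entry in row \<open>r'\<close> and column \<open>c\<close> has weight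
  \<open>xs c - r'\<close>. The column indices sum to \<open>N + (0 + ... + (l - 1))\<close>, the
  remaining row indices to \<open>(0 + ... + l) - r\<close>.\<close>

lemma wcof_homogeneous:
  assumes "r \<le> l"
  shows "wbound 1 2 (int (N - l + r)) (wcof r)" "wbound (- 1) (- 2) (- int (N - l + r)) (wcof r)"
proof -
  \<comment> \<open>The enumeration of the rows 0, ..., \<open>l\<close> that are left when row
    \<open>r\<close> is deleted.\<close>
  define ins where "ins i = (if i < r then i else Suc i)" for i
  define D where "D = mat l l (\<lambda>(i, c). (pderiv ^^ ins i) (Hpoly (xs c)))"
  have w: "wcof r = (- 1) ^ (r + l) * det D"
    unfolding wcof_def cofactor_def mat_delete_def D_def
    by (auto simp: ins_def intro!: arg_cong[of _ _ det] eq_matI)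
  have "(\<Sum>i<l. int (ins i)) = (\<Sum>i<l. int i + (if i < r then 0 else 1))"
    by (rule sum.cong) (auto simp: ins_def)
  also have "\<dots> = (\<Sum>i<l. int i) + int (card ({..<l} - {..<r}))"
    by (simp add: sum.distrib sum.If_cases Diff_eq Compl_eq)
  also have "card ({..<l} - {..<r}) = l - r"
    using assms by (subst card_Diff_subset) auto
  finally have sum: "(\<Sum>i<l. - int (ins i)) + (\<Sum>c<l. xs c) = int (N - l + r)"
    using assms part_len_le_size by (simp add: sum_xs sum_negf of_nat_diff)
  have "wbound 1 2 ((\<Sum>i<l. - int (ins i)) + (\<Sum>c<l. xs c)) (det D)"
    by (rule wbound_det)
      (auto simp: D_def higher_pderiv_Hpoly intro!: wbound_smult wbound_mono[OF wbound_Hpoly(1)])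
  moreover have "wbound (- 1) (- 2) ((\<Sum>i<l. int (ins i)) + (\<Sum>c<l. - xs c)) (det D)"
    by (rule wbound_det)
      (auto simp: D_def higher_pderiv_Hpoly intro!: wbound_smult wbound_mono[OF wbound_Hpoly(2)])
  moreover have "(\<Sum>i<l. int (ins i)) + (\<Sum>c<l. - xs c) = - int (N - l + r)"
    using sum by (simp add: sum_negf)
  ultimately have "wbound 1 2 (int (N - l + r)) (det D)" "wbound (- 1) (- 2) (- int (N - l + r)) (det D)"
    using sum by simp_all
  then show "wbound 1 2 (int (N - l + r)) (wcof r)" "wbound (- 1) (- 2) (- int (N - l + r)) (wcof r)"
    unfolding w by (cases "even (r + l)"; simp)+
qed

end

section \<open>The polynomials at z = 1\<close>

abbreviation ev10 :: "complex poly poly \<Rightarrow> complex" where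
  "ev10 p \<equiv> poly (poly p 1) 0"

interpretation ev10: comm_ring_hom ev10
  by (rule comm_ring_homI) simp_all

text \<open>At \<open>y = 0\<close> only pure powers of \<open>x\<close> survive, and the weight
  leaves just one. Evaluation commutes with determinants, so top coefficients can be computed
  entrywise.\<close>

lemma ev10_homogeneous:
  assumes "wbound 1 2 (int w) p" "wbound (- 1) (- 2) (- int w) p"
  shows "ev10 p = coeff (coeff p w) 0"
proof -
  have "ev10 p = (\<Sum>i\<le>degree p. coeff (coeff p i) 0)"
    by (simp add: poly_altdef[of p] poly_sum poly_0_coeff_0 coeff_sum)
  also have "\<dots> = (\<Sum>i\<le>degree p. if i = w then coeff (coeff p w) 0 else 0)"
  proof (rule sum.cong)
    fix i
    have "i = w" if "coeff (coeff p i) 0 \<noteq> 0"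
      using assms that unfolding wbound_def by force
    then show "coeff (coeff p i) 0 = (if i = w then coeff (coeff p w) 0 else 0)" by auto
  qed simp
  also have "\<dots> = coeff (coeff p w) 0"
    by (simp add: coeff_eq_0)
  finally show ?thesis .
qed

lemma yGP_sum: "yGP (\<Sum>i\<in>A. f i) = (\<Sum>i\<in>A. yGP (f i))"
  by (simp only: yGP_def lin_ext_sum)

lemma yGP_diff: "yGP (p - q) = yGP p - yGP q"
  by (simp only: yGP_def lin_ext_diff)

lemma yGP_monom: "yGP (monom q i) = [:q:] * GP i"
proof -
  have y: "smult [:a:] (yP ^ j) = [:monom a j:]" for a j
    using monom_eq_xP_yP[of a j 0] by (simp add: monom_0)
  have "monom q i = (\<Sum>j\<le>degree q. monom (monom (coeff q j) j) i)"
    by (simp add: poly_as_sum_of_monoms flip: monom_sum)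
  then have "yGP (monom q i) = (\<Sum>j\<le>degree q. smult [:coeff q j:] (yP ^ j * GP i))"
    unfolding yGP_def by (metis (no_types, lifting) lin_ext_monom lin_ext_sum sum.cong)
  also have "\<dots> = (\<Sum>j\<le>degree q. [:monom (coeff q j) j:]) * GP i"
    by (simp only: sum_distrib_right y[symmetric] mult_smult_left)
  also have "(\<Sum>j\<le>degree q. [:monom (coeff q j) j:]) = [:q:]"
    by (metis (no_types, lifting) monom_0 monom_sum poly_as_sum_of_monoms sum.cong)
  finally show ?thesis .
qed

lemma yGP_eq:
  assumes "degree p \<le> n"
  shows "yGP p = (\<Sum>i\<le>n. [:coeff p i:] * GP i)"
proof -
  have "yGP p = yGP (\<Sum>i\<le>n. monom (coeff p i) i)"
    using assms by (simp add: poly_as_sum_of_monoms')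
  then show ?thesis by (simp only: yGP_sum yGP_monom)
qed

lemma sum_smult: "(\<Sum>i\<in>A. smult c (f i)) = smult c (\<Sum>i\<in>A. f i)"
  by (induction A rule: infinite_finite_induct) (simp_all add: smult_add_right)

lemma wbound_lin_ext:
  assumes "\<And>i j. coeff (coeff p i) j \<noteq> 0 \<Longrightarrow> wbound a b w (c i j)"
  shows "wbound a b w (lin_ext c p)"
  unfolding lin_ext_def
  by (rule wbound_sum) (auto simp: psupp_def intro!: wbound_smult assms)

lemma wbound_GP_args: "wbound 1 1 1 (xP - 2 * yP)" "wbound 1 1 1 (- yP)"
proof -
  have "wbound 1 1 (0 + 1) (of_int 2 * yP)"
    by (intro wbound_mult wbound_of_int wbound_yP) simp_all
  then show "wbound 1 1 1 (xP - 2 * yP)"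
    by (intro wbound_diff wbound_xP) simp_all
  show "wbound 1 1 1 (- yP)" unfolding wbound_uminus by (rule wbound_yP) simp
qed

text \<open>The extreme coefficients of the top part of \<open>KP\<close>: the first makes
  \<open>coeff (Knat lam) 0\<close> monic, the second gives the degree of
  \<open>Knat lam\<close>.\<close>

lemma coeff_GP_top:
  "coeff (coeff ((xP - 2 * yP) ^ n) n) 0 = 1" "coeff (coeff ((xP - 2 * yP) ^ n) 0) n = (- 2) ^ n"
proof -
  have *: "xP - 2 * yP = [:monom (- 2) 1, 1:]"
    by (simp add: monom_altdef numeral_poly)
  show "coeff (coeff ((xP - 2 * yP) ^ n) n) 0 = 1"
    unfolding * by (simp add: coeff_linear_power)
  show "coeff (coeff ((xP - 2 * yP) ^ n) 0) n = (- 2) ^ n"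
    unfolding * by (simp add: coeff_0_power monom_power)
qed

context partition
begin

text \<open>\<open>Phi\<close> and \<open>Kpoly\<close> at \<open>z = 1\<close>; homogeneity recovers the powers of \<open>z\<close>.\<close>

definition PhiP :: "complex poly poly" where
  "PhiP = smult [:1 / vander lam:] (\<Sum>r<Suc l. wcof r)"

definition KP :: "complex poly poly" where
  "KP = yGP PhiP"

text \<open>By homogeneity the operator multiplies each \<open>wcof r\<close> by
  \<open>Hpoly (m - int r)\<close>. The falling factorial splits into a common factor and
  \<open>ff r m\<close>, which makes this the \<open>r\<close>-th derivative of
  \<open>Hpoly m\<close>; the sum is the expanded Wronskian.\<close>

lemma lin_ext_cop_KP:
  "lin_ext (cop n) KP = smult [:ff (N - l) n / vander lam:]
     (wronskian (map (\<lambda>i. Hpoly (pk lam i)) (rev [1..<Suc l]) @ [Hpoly (n - int N + int l)]))"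
proof -
  define m where "m = n - int N + int l"
  have "lin_ext (cop n) (yGP (wcof r)) = smult [:ff (N - l) n:] ((pderiv ^^ r) (Hpoly m) * wcof r)"
    if "r < Suc l" for r
  proof -
    have "lin_ext (cop n) (yGP (wcof r)) =
        smult [:ff (N - l + r) n:] (Hpoly (n - int (N - l + r)) * wcof r)"
      by (rule lin_ext_cop_yGP_homogeneous) (use wcof_homogeneous[of r] that in auto)
    also have "ff (N - l + r) n = ff (N - l) n * ff r m"
      using ff_add[of "N - l" r n] part_len_le_size by (simp add: m_def of_nat_diff algebra_simps)
    also have "n - int (N - l + r) = m - int r"
      using part_len_le_size by (simp add: m_def)
    finally show ?thesis by (simp add: higher_pderiv_Hpoly mult.commute)
  qed
  then have "lin_ext (cop n) KP =
      smult [:1 / vander lam:] (\<Sum>r<Suc l. smult [:ff (N - l) n:] ((pderiv ^^ r) (Hpoly m) * wcof r))"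
    unfolding KP_def PhiP_def yGP_def lin_ext_smult lin_ext_sum
    by (intro arg_cong2[where f = smult] sum.cong) simp_all
  also have "\<dots> = smult [:ff (N - l) n / vander lam:] (\<Sum>r<Suc l. (pderiv ^^ r) (Hpoly m) * wcof r)"
    by (simp add: sum_smult)
  finally show ?thesis
    unfolding wronskian_eq m_def .
qed

lemma wbound_PhiP: "wbound 1 2 (int N) PhiP"
  unfolding PhiP_def
  by (intro wbound_smult wbound_sum)
    (rule wbound_mono[OF wcof_homogeneous(1)], use part_len_le_size in auto)

text \<open>Only the last cofactor reaches weight \<open>N\<close>; its value at
  \<open>x = 1\<close>, \<open>y = 0\<close> is the determinant of \<open>det_ff\<close>, that is,
  \<open>vander lam\<close>.\<close>

lemma coeff_PhiP_top: "coeff (coeff PhiP N) 0 = 1"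
proof -
  have "coeff (coeff (wcof r) N) 0 = 0" if "r < l" for r
    using wcof_homogeneous(1)[of r] that part_len_le_size unfolding wbound_def by force
  then have "coeff (coeff PhiP N) 0 = 1 / vander lam * coeff (coeff (wcof l) N) 0"
    by (simp add: PhiP_def coeff_sum)
  also have "coeff (coeff (wcof l) N) 0 = ev10 (wcof l)"
    using wcof_homogeneous[of l] part_len_le_size by (intro ev10_homogeneous[symmetric]) simp_all
  also have "wcof l = det (mat l l (\<lambda>(r, c). (pderiv ^^ r) (Hpoly (xs c))))"
    unfolding wcof_def cofactor_def mat_delete_def
    by (auto intro!: arg_cong[of _ _ det] eq_matI)
  also have "ev10 \<dots> = det (map_mat ev10 (mat l l (\<lambda>(r, c). (pderiv ^^ r) (Hpoly (xs c)))))"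
    by simp
  also have "map_mat ev10 (mat l l (\<lambda>(r, c). (pderiv ^^ r) (Hpoly (xs c)))) =
      mat l l (\<lambda>(r, c). ff r (xs c))"
  proof (rule eq_matI)
    fix r c assume "r < dim_row (mat l l (\<lambda>(r, c). ff r (xs c)))" "c < dim_col (mat l l (\<lambda>(r, c). ff r (xs c)))"
    then have rc: "r < l" "c < l" by simp_all
    \<comment> \<open>Either \<open>Hpoly\<close> takes the value 1 at this point, or the order of
      the derivative exceeds the degree and the falling factorial is 0.\<close>
    have "ff r (xs c) * ev10 (Hpoly (xs c - int r)) = ff r (xs c)"
    proof (cases "int r \<le> xs c")
      case True
      then obtain k where k: "xs c - int r = int k" by (metis diff_ge_0_iff_ge nonneg_int_cases)
      have "ev10 (Hpoly (int k)) = 1"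
        using ev10_homogeneous[OF wbound_Hpoly] by (simp add: Hpoly_y0)
      then show ?thesis by (simp add: k)
    qed (use xs_nonneg[OF rc(2)] in \<open>simp add: ff_eq_0\<close>)
    then show "map_mat ev10 (mat l l (\<lambda>(r, c). (pderiv ^^ r) (Hpoly (xs c)))) $$ (r, c) =
        mat l l (\<lambda>(r, c). ff r (xs c)) $$ (r, c)"
      using rc by (simp add: higher_pderiv_Hpoly)
  qed simp_all
  also have "det \<dots> = vander lam"
    unfolding vander_eq by (rule det_ff[OF xs_inj])
  finally show ?thesis using vander_neq_0 by simp
qed

lemma degree_PhiP: "degree PhiP \<le> N"
proof (rule degree_le, intro allI impI)
  fix i assume "N < i"
  then have "coeff (coeff PhiP i) j = 0" for j
    using wbound_PhiP unfolding wbound_def by force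
  then show "coeff PhiP i = 0" by (simp add: poly_eq_iff)
qed

text \<open>By its weight, \<open>PhiP\<close> has \<open>x^N\<close> as its only monomial of total
  degree at least \<open>N\<close>. Replacing \<open>x^a\<close> by \<open>GP a\<close> does not
  raise total degrees, and the top part of \<open>GP N\<close> is \<open>(x - 2y)^N\<close>.\<close>

lemma wbound_KP_top: "wbound 1 1 (int N - 1) (KP - (xP - 2 * yP) ^ N)"
proof -
  have top: "yGP (monom 1 N) = GP N"
    by (simp add: yGP_monom one_pCons[symmetric])
  have "wbound 1 1 (int N - 1) (yGP (PhiP - monom 1 N))"
    unfolding yGP_def
  proof (rule wbound_lin_ext)
    fix i j assume ij: "coeff (coeff (PhiP - monom 1 N) i) j \<noteq> 0"
    have "int i + int j \<le> int N - 1"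
    proof (cases "i = N \<and> j = 0")
      case True
      then show ?thesis using ij coeff_PhiP_top by simp
    next
      case False
      then have "coeff (coeff PhiP i) j \<noteq> 0"
        using ij by (auto simp: coeff_1 split: if_splits)
      then have "int i + 2 * int j \<le> int N"
        using wbound_PhiP unfolding wbound_def by force
      then show ?thesis using False by linarith
    qed
    moreover have "wbound 1 1 (0 + int j * 1 + int i * 1) (yP ^ j * GP i)"
    proof -
      have "wbound 1 1 (\<Sum>k<j. 1) (\<Prod>k<j. yP)"
        by (intro wbound_prod wbound_yP) simp
      then have "wbound 1 1 (0 + int j * 1) (yP ^ j)" by simp
      moreover have "wbound 1 1 (int i * 1) (GP i)"
        by (intro wbound_hermite wbound_GP_args wbound_mono[OF wbound_GP_args(2)]) simp
      ultimately show ?thesis by (rule wbound_mult)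
    qed
    ultimately show "wbound 1 1 (int N - 1) (yP ^ j * GP i)"
      by (auto intro: wbound_mono)
  qed
  moreover have "wbound 1 1 (int N * 1 - 1) (GP N - (xP - 2 * yP) ^ N)"
    by (intro wbound_hermite_top wbound_GP_args wbound_mono[OF wbound_GP_args(2)]) simp
  ultimately have "wbound 1 1 (int N - 1) (yGP (PhiP - monom 1 N) + (GP N - (xP - 2 * yP) ^ N))"
    by (intro wbound_add) simp_all
  then show ?thesis
    by (simp only: KP_def yGP_diff top add_diff_eq diff_add_cancel)
qed

lemma coeff_KP_top:
  assumes "N \<le> i + j"
  shows "coeff (coeff KP i) j = coeff (coeff ((xP - 2 * yP) ^ N) i) j"
  using wbound_KP_top assms unfolding wbound_def by force

lemma coeff_KP_high:
  assumes "N < i + j"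
  shows "coeff (coeff KP i) j = 0"
proof -
  have "wbound 1 1 (\<Sum>k<N. 1) (\<Prod>k<N. xP - 2 * yP)"
    by (intro wbound_prod wbound_GP_args)
  then have "wbound 1 1 (int N) ((xP - 2 * yP) ^ N)" by simp
  then show ?thesis
    using assms coeff_KP_top[of i j] unfolding wbound_def by force
qed

end

section \<open>The operator of the statement\<close>

lemma zA_power: "zA ^ n = [:fls_X ^ n:]"
  by (induction n) (simp_all add: zA_def one_pCons)

context partition
begin

lemma thetaA_det:
  "thetaA (det (mat n n (\<lambda>(i, j). e i j))) = det (mat n n (\<lambda>(i, j). thetaA (e i j)))"
proof -
  have "map_mat thetaA (mat n n (\<lambda>(i, j). e i j)) = mat n n (\<lambda>(i, j). thetaA (e i j))"
    by (rule eq_matI) auto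
  then show ?thesis by (metis thetaA.hom_det)
qed

text \<open>The power of \<open>z\<close> that clears an entry of the Schur matrix is a product of a
  row factor and a column factor; over the whole determinant these multiply to
  \<open>z^N\<close>.\<close>

lemma thetaA_PhiP: "zA ^ N * Phi lam = thetaA PhiP"
proof -
  define t where "t = (\<lambda>k. (if k = 1 then xA else if k = 2 then yA else 0) - cA (1 / of_nat k) * zinvA ^ k)"
  define k where "k i j = int (lam (Suc i)) - int i + int j" for i j
  define b where "b i j = bell cA (k i j) t" for i j
  define e where "e i j = hP (k i j) - hP (k i j - 1)" for i j
  \<comment> \<open>The exponent \<open>k i j\<close> can be negative, so \<open>zA ^ i\<close> is
    kept on the right; the factor 1 matches the shape of \<open>det_mat_scale\<close>.\<close>
  have be: "zA ^ lam (Suc i) * zA ^ j * b i j = zA ^ i * 1 * thetaA (e i j)" for i j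
  proof (cases "k i j < 0")
    case True
    then show ?thesis by (simp add: b_def e_def bell_def)
  next
    case False
    then obtain m where m: "k i j = int m" by (metis nonneg_int_cases not_le_imp_less)
    then have "lam (Suc i) + j = i + m" by (simp add: k_def)
    then have "zA ^ lam (Suc i) * zA ^ j = zA ^ i * zA ^ m" by (metis power_add)
    moreover have "zA ^ m * b i j = thetaA (e i j)"
      unfolding b_def e_def m t_def by (rule thetaA_bell)
    ultimately show ?thesis by (simp add: mult.assoc)
  qed
  have "zA ^ N * (\<Prod>j<l. zA ^ j) * det (mat l l (\<lambda>(i, j). b i j)) =
      det (mat l l (\<lambda>(i, j). zA ^ lam (Suc i) * zA ^ j * b i j))"
    by (simp only: det_mat_scale part_size_eq power_sum)
  also have "\<dots> = (\<Prod>j<l. zA ^ j) * (\<Prod>j<l. 1) * det (mat l l (\<lambda>(i, j). thetaA (e i j)))"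
    by (simp only: be det_mat_scale)
  finally have "(\<Prod>j<l. zA ^ j) * (zA ^ N * det (mat l l (\<lambda>(i, j). b i j))) =
      (\<Prod>j<l. zA ^ j) * thetaA (det (mat l l (\<lambda>(i, j). e i j)))"
    by (simp add: thetaA_det mult_ac)
  moreover have "(\<Prod>j<l. zA ^ j) \<noteq> 0" by (simp add: zA_neq_0)
  ultimately have 1: "zA ^ N * det (mat l l (\<lambda>(i, j). b i j)) = thetaA (det (mat l l (\<lambda>(i, j). e i j)))"
    by simp
  define P where "P = (\<Prod>i = 1..l. fact (nat (pk lam i)) :: complex)"
  have "P \<noteq> 0" by (simp add: P_def)
  then have C: "fact N / dlam lam = P / vander lam"
    by (simp add: dlam_def P_def)
  have "schur cA lam t = det (mat l l (\<lambda>(i, j). b i j))"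
    by (simp only: schur_def b_def k_def)
  then have "Phi lam = cA (P / vander lam) * det (mat l l (\<lambda>(i, j). b i j))"
    by (simp only: Phi_def C t_def)
  then have "zA ^ N * Phi lam = cA (P / vander lam) * thetaA (det (mat l l (\<lambda>(i, j). e i j)))"
    unfolding 1[symmetric]
    by (simp only: mult_ac)
  also have "\<dots> = thetaA (smult [:P / vander lam:] (det (mat l l (\<lambda>(i, j). e i j))))"
    by (simp only: smult_const2 thetaA.hom_mult thetaA_const2)
  also have "smult [:P / vander lam:] (det (mat l l (\<lambda>(i, j). e i j))) = PhiP"
    unfolding e_def k_def det_hP PhiP_def P_def[symmetric] using \<open>P \<noteq> 0\<close> by simp
  finally show ?thesis .
qed

text \<open>In each summand \<open>zA ^ N\<close> is split between the coefficient of
  \<open>Phi lam\<close>, which takes \<open>zA ^ i\<close>, and the Hermite polynomial, which takes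
  the rest.\<close>

lemma thetaA_KP: "zA ^ N * Kpoly lam = thetaA KP"
proof -
  have zpow: "zA ^ n * [:q:] = [:fls_X ^ n * q:]" for n q
    by (simp add: zA_power)
  have X: "fls_X ^ i * coeff (Phi lam) (N - i) = psiA (coeff PhiP (N - i))" if "i \<le> N" for i
  proof -
    have "fls_X ^ N * coeff (Phi lam) (N - i) = coeff (thetaA PhiP) (N - i)"
      by (simp add: zA_power flip: thetaA_PhiP)
    also have "\<dots> = fls_X ^ (N - i) * psiA (coeff PhiP (N - i))"
      by (rule coeff_thetaA)
    also have "fls_X ^ N = fls_X ^ (N - i) * fls_X ^ i"
      using that by (simp flip: power_add)
    finally have "fls_X ^ (N - i) * (fls_X ^ i * coeff (Phi lam) (N - i)) =
        fls_X ^ (N - i) * psiA (coeff PhiP (N - i))"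
      by (simp only: mult.assoc)
    then show ?thesis by simp
  qed
  have "zA ^ N * Kpoly lam = (\<Sum>i = 0..N. thetaA ([:coeff PhiP (N - i):] * GP (N - i)))"
    unfolding Kpoly_def sum_distrib_left
  proof (rule sum.cong)
    fix i assume "i \<in> {0..N}"
    then have i: "i \<le> N" by simp
    have "zA ^ N * ([:coeff (Phi lam) (N - i):] * hermite cA (int N - int i) (xA - 2 * yA * zA) (- yA)) =
        (zA ^ i * [:coeff (Phi lam) (N - i):]) *
        (zA ^ (N - i) * hermite cA (int (N - i)) (xA - 2 * yA * zA) (- yA))"
    proof -
      have "zA ^ N = zA ^ i * zA ^ (N - i)" using i by (simp flip: power_add)
      then show ?thesis using i by (simp only: of_nat_diff mult_ac)
    qed
    also have "\<dots> = thetaA ([:coeff PhiP (N - i):] * GP (N - i))"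
      by (simp only: zpow X[OF i] thetaA.hom_mult thetaA_const thetaA_GP)
    finally show "zA ^ N * ([:coeff (Phi lam) (N - i):] * hermite cA (int N - int i) (xA - 2 * yA * zA) (- yA)) =
        thetaA ([:coeff PhiP (N - i):] * GP (N - i))" .
  qed simp
  also have "\<dots> = thetaA (\<Sum>i = 0..N. [:coeff PhiP (N - i):] * GP (N - i))"
    by (simp only: thetaA.hom_sum)
  also have "(\<Sum>i = 0..N. [:coeff PhiP (N - i):] * GP (N - i)) = (\<Sum>i = 0..N. [:coeff PhiP i:] * GP i)"
    by (rule sum.reindex_bij_witness[of _ "\<lambda>i. N - i" "\<lambda>i. N - i"]) auto
  also have "\<dots> = KP"
    unfolding KP_def yGP_eq[OF degree_PhiP] atMost_atLeast0 ..
  finally show ?thesis .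
qed

text \<open>The exponent of \<open>z\<close> in \<open>Kcoeff\<close> is the one that homogeneity
  attaches to \<open>x^i y^j\<close>.\<close>

lemma Kcoeff_eq: "Kcoeff lam i j = coeff (coeff KP i) j"
proof -
  have "fls_X ^ N * coeff (Kpoly lam) i = fls_X ^ i * psiA (coeff KP i)"
    using arg_cong[OF thetaA_KP, of "\<lambda>p. coeff p i"] by (simp add: coeff_thetaA zA_power)
  then have "fls_nth (coeff (Kpoly lam) i) (int i + 2 * int j - int N) = fls_nth (psiA (coeff KP i)) (2 * int j)"
    using arg_cong[of _ _ "\<lambda>f. fls_nth f (int i + 2 * int j)"] fls_X_power_times_nth
    by (metis add_diff_cancel_left')
  then show ?thesis
    by (simp add: Kcoeff_def psiA_nth)
qed

section \<open>Coefficients of \<open>Knat\<close> and its degree in \<open>y\<close>\<close>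

lemma coeff_Knat:
  "coeff (Knat lam) j = (\<Sum>i\<le>N. smult (coeff (coeff KP i) j) (ffact_poly (i + 2 * j)))"
proof -
  have "coeff (Knat lam) j =
      (if j \<le> N then \<Sum>i = 0..N - j. smult (Kcoeff lam i j) (ffact_poly (i + 2 * j)) else 0)"
  proof -
    have "coeff (Knat lam) j = (\<Sum>j' = 0..N. if j' = j then
        \<Sum>i = 0..N - j. smult (Kcoeff lam i j) (ffact_poly (i + 2 * j)) else 0)"
      unfolding Knat_def coeff_sum by (rule sum.cong) auto
    then show ?thesis by simp
  qed
  \<comment> \<open>The triangular range extends to a full one because \<open>KP\<close> has total
    degree at most \<open>N\<close>.\<close>
  also have "\<dots> = (\<Sum>i\<le>N. smult (coeff (coeff KP i) j) (ffact_poly (i + 2 * j)))"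
  proof (cases "j \<le> N")
    case True
    then show ?thesis
      unfolding Kcoeff_eq
      by (auto simp: coeff_KP_high intro!: sum.mono_neutral_left)
  qed (auto simp: coeff_KP_high intro!: sum.neutral[symmetric])
  finally show ?thesis .
qed

lemma poly_coeff_Knat: "poly (coeff (Knat lam) j) (of_int n) = (\<Sum>i\<le>N. coeff (coeff KP i) j * ff (i + 2 * j) n)"
  by (simp add: coeff_Knat poly_sum ff_def)

lemma coeff_Knat_high: "N < j \<Longrightarrow> coeff (Knat lam) j = 0"
  by (simp add: coeff_Knat coeff_KP_high)

lemma degree_Knat: "degree (Knat lam) = N"
proof (rule antisym)
  show "degree (Knat lam) \<le> N"
    by (rule degree_le) (simp add: coeff_Knat_high)
  \<comment> \<open>Only the monomial \<open>y^N\<close> of \<open>KP\<close> contributes, and it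
    comes from \<open>(x - 2y)^N\<close>.\<close>
  have "coeff (Knat lam) N = (\<Sum>i\<le>N. if i = 0 then smult ((- 2) ^ N) (ffact_poly (2 * N)) else 0)"
    unfolding coeff_Knat
  proof (rule sum.cong)
    fix i
    show "smult (coeff (coeff KP i) N) (ffact_poly (i + 2 * N)) =
        (if i = 0 then smult ((- 2) ^ N) (ffact_poly (2 * N)) else 0)"
    proof (cases i)
      case 0
      have "coeff (coeff KP 0) N = (- 2) ^ N"
        using coeff_KP_top[of 0 N] coeff_GP_top(2)[of N] by (simp only: add_0 order_refl)
      then show ?thesis by (simp add: 0)
    qed (simp add: coeff_KP_high)
  qed simp
  also have "\<dots> \<noteq> 0"
    using ffact_poly_monic(2)[of "2 * N"] by auto
  finally show "N \<le> degree (Knat lam)" by (rule le_degree)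
qed

text \<open>The value of the operator on \<open>Hpoly\<close> is linear in \<open>KP\<close>, and
  \<open>cop n i j\<close> is the contribution of \<open>x^i y^j\<close>; grouping by powers of
  \<open>y\<close> gives the coefficients of \<open>Knat\<close>.\<close>

lemma shift_op_Knat: "shift_op smult (Knat lam) Hpoly n = lin_ext (cop n) KP"
proof -
  have "lin_ext (cop n) KP = (\<Sum>(i, j)\<in>{..N} \<times> {..N}. smult [:coeff (coeff KP i) j:] (cop n i j))"
  proof (rule lin_ext_superset)
    have "i + j \<le> N" if "coeff (coeff KP i) j \<noteq> 0" for i j
      using that coeff_KP_high not_le by blast
    then show "psupp KP \<subseteq> {..N} \<times> {..N}"
      by (fastforce simp: psupp_def)
  qed simp
  also have "\<dots> = (\<Sum>i\<le>N. \<Sum>j\<le>N. smult [:coeff (coeff KP i) j:] (cop n i j))"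
    by (simp add: sum.cartesian_product)
  also have "\<dots> = (\<Sum>j\<le>N. \<Sum>i\<le>N. smult [:coeff (coeff KP i) j:] (cop n i j))"
    by (rule sum.swap)
  also have "\<dots> = (\<Sum>j\<le>N. smult (monom (poly (coeff (Knat lam) j) (of_int n)) j) (Hpoly (n - 2 * int j)))"
  proof (rule sum.cong)
    fix j
    have y: "smult (monom a j) q = [:[:a:]:] * (yP ^ j * q)" for a q
    proof -
      have "[:monom a j:] = [:[:a:]:] * yP ^ j"
        using monom_eq_xP_yP[of a j 0] by (simp add: monom_0)
      moreover have "smult (monom a j) q = [:monom a j:] * q" by simp
      ultimately show ?thesis by (simp only: mult.assoc)
    qed
    show "(\<Sum>i\<le>N. smult [:coeff (coeff KP i) j:] (cop n i j)) =
        smult (monom (poly (coeff (Knat lam) j) (of_int n)) j) (Hpoly (n - 2 * int j))"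
      unfolding y poly_coeff_Knat const2.hom_sum sum_distrib_right cop_def smult_const2 const2.hom_mult mult.assoc ..
  qed simp
  finally show ?thesis
    unfolding shift_op_def degree_Knat ..
qed

end

section \<open>Zeros and the factor kappa\<close>

lemma prod_linear_dvd:
  fixes p :: "complex poly"
  assumes "finite A" "inj_on r A" "\<And>i. i \<in> A \<Longrightarrow> poly p (r i) = 0"
  shows "(\<Prod>i\<in>A. [:- r i, 1:]) dvd p"
  using assms
proof (induction A)
  case (insert a A)
  then have "(\<Prod>i\<in>A. [:- r i, 1:]) dvd p" by simp
  then obtain q where q: "p = (\<Prod>i\<in>A. [:- r i, 1:]) * q" by (elim dvdE)
  have "poly p (r a) = 0" using insert.prems by simp
  moreover have "poly (\<Prod>i\<in>A. [:- r i, 1:]) (r a) \<noteq> 0"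
    using insert.hyps insert.prems(1) by (auto simp: poly_prod inj_on_def)
  ultimately have "[:- r a, 1:] dvd q" by (simp add: q poly_eq_0_iff_dvd)
  then show ?case
    unfolding q prod.insert[OF insert.hyps] by (metis mult.commute mult_dvd_mono dvd_refl)
qed simp

context partition
begin

lemma root_nonneg: "1 \<le> i \<Longrightarrow> i \<le> N \<Longrightarrow> 0 \<le> pm lam i + int N"
  by (simp add: pm_def)

text \<open>For \<open>i \<le> l\<close> the last Hermite index is \<open>pk lam i\<close>, so the
  Wronskian has two equal columns. For \<open>i > l\<close> the argument is \<open>N - i\<close>, a
  zero of the falling factorial of order \<open>N - l\<close>.\<close>

lemma lin_ext_cop_KP_root:
  assumes "1 \<le> i" "i \<le> N"
  shows "lin_ext (cop (pm lam i + int N)) KP = 0"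
proof (cases "i \<le> l")
  case True
  define M where "M = mat (Suc l) (Suc l) (\<lambda>(r, c). if c < l then (pderiv ^^ r) (Hpoly (xs c))
    else (pderiv ^^ r) (Hpoly (pk lam i)))"
  have "det M = 0"
    by (rule det_identical_columns[of M "Suc l" "l - i" l])
      (use True \<open>1 \<le> i\<close> in \<open>auto simp: M_def xs_def intro!: eq_vecI\<close>)
  moreover have "pm lam i + int N - int N + int l = pk lam i" by (simp add: pk_def)
  ultimately show ?thesis
    unfolding lin_ext_cop_KP wronskian_eq det_border[symmetric] M_def by (simp only: smult_0_right)
next
  case False
  then have "ff (N - l) (pm lam i + int N) = 0"
    using root_nonneg[OF assms] by (intro ff_eq_0) (auto simp: pm_def lam_0)
  then show ?thesis by (simp add: lin_ext_cop_KP)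
qed

text \<open>The vanishing combination of Hermite polynomials is triangular, so its coefficients
  vanish one after another.\<close>

lemma poly_coeff_Knat_root:
  assumes i: "1 \<le> i" "i \<le> N"
  shows "poly (coeff (Knat lam) j) (of_int (pm lam i + int N)) = 0"
proof -
  define n where "n = nat (pm lam i + int N)"
  have n: "pm lam i + int N = int n"
    using root_nonneg[OF i] by (simp add: n_def)
  define q where "q j = poly (coeff (Knat lam) j) (of_int (int n))" for j
  have sum: "(\<Sum>j\<le>N. smult (monom (q j) j) (Hpoly (int n - 2 * int j))) = 0"
    using shift_op_Knat[of "int n"] lin_ext_cop_KP_root[OF i]
    by (simp only: shift_op_def degree_Knat n q_def)
  have "q j = 0"
  proof (induction j rule: less_induct)
    case (less j)
    consider "N < j" | "n < 2 * j" | "j \<le> N" "2 * j \<le> n" by linarith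
    then show ?case
    proof cases
      case 1
      then show ?thesis by (simp add: q_def coeff_Knat_high)
    next
      \<comment> \<open>Here the Hermite index is negative and the relation carries no information
        on \<open>q j\<close>; the falling factorials in \<open>q j\<close> vanish instead.\<close>
      case 2
      then have "ff (i + 2 * j) (int n) = 0" for i by (intro ff_eq_0) auto
      then show ?thesis by (simp only: q_def poly_coeff_Knat) simp
    next
      case 3
      \<comment> \<open>At \<open>x^(n - 2j) y^j\<close>, summands with larger index have too high a
        power of \<open>y\<close>, those with smaller index vanish by induction, and the remaining
        one gives \<open>q j\<close> by \<open>Hpoly_y0\<close>.\<close>
      have "0 = coeff (coeff (\<Sum>j'\<le>N. smult (monom (q j') j') (Hpoly (int n - 2 * int j'))) (n - 2 * j)) j"
        by (simp add: sum)
      also have "\<dots> = (\<Sum>j'\<le>N. if j' = j then q j else 0)"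
        unfolding coeff_sum
      proof (rule sum.cong)
        fix j'
        have "coeff (coeff (Hpoly (int n - 2 * int j)) (n - 2 * j)) 0 = 1"
          using Hpoly_y0[of "n - 2 * j" "n - 2 * j"] 3(2) by (simp add: of_nat_diff)
        then show "coeff (coeff (smult (monom (q j') j') (Hpoly (int n - 2 * int j'))) (n - 2 * j)) j =
            (if j' = j then q j else 0)"
          using less.IH[of j'] by (cases "j' < j") (auto simp: coeff_monom_mult)
      qed simp
      also have "\<dots> = q j" using 3 by simp
      finally show ?thesis by simp
    qed
  qed
  then show ?thesis by (simp add: q_def n)
qed

lemma kappa_dvd: "kappa lam dvd coeff (Knat lam) j"
  unfolding kappa_def
proof (rule prod_linear_dvd)
  show "inj_on (\<lambda>i. complex_of_int (pm lam i + int N)) {1..N}"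
    using pm_inj by (auto simp: inj_on_def)
  show "poly (coeff (Knat lam) j) (of_int (pm lam i + int N)) = 0" if "i \<in> {1..N}" for i
    using that by (intro poly_coeff_Knat_root) auto
qed simp

lemma kappa_monic: "degree (kappa lam) = N" "lead_coeff (kappa lam) = 1"
proof -
  show "lead_coeff (kappa lam) = 1"
    unfolding kappa_def lead_coeff_prod by simp
  show "degree (kappa lam) = N"
    unfolding kappa_def by (subst degree_prod_eq_sum_degree) auto
qed

lemma kappa_neq_0: "kappa lam \<noteq> 0"
  using kappa_monic(2) by auto

text \<open>The left side is divisible by the monic \<open>kappa lam\<close> of degree
  \<open>N\<close>, has degree at most \<open>N\<close> and is itself monic.\<close>

lemma coeff_Knat_0: "coeff (Knat lam) 0 = kappa lam"
proof -
  have K: "coeff (Knat lam) 0 = (\<Sum>i\<le>N. smult (coeff (coeff KP i) 0) (ffact_poly i))"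
    by (simp add: coeff_Knat)
  have deg: "degree (coeff (Knat lam) 0) \<le> N"
    unfolding K by (rule degree_sum_le) (auto intro: order_trans[OF degree_smult_le] simp: ffact_poly_monic)
  have top: "coeff (coeff (Knat lam) 0) N = 1"
  proof -
    have "coeff (coeff (Knat lam) 0) N = (\<Sum>i\<le>N. if i = N then coeff (coeff KP N) 0 else 0)"
      unfolding K coeff_sum by (rule sum.cong) (auto simp: coeff_ffact_poly)
    also have "\<dots> = 1"
      using coeff_KP_top[of N 0] coeff_GP_top(1)[of N] by simp
    finally show ?thesis .
  qed
  obtain R where R: "coeff (Knat lam) 0 = kappa lam * R"
    using kappa_dvd[of 0] by (elim dvdE)
  with top have "R \<noteq> 0" by auto
  then have "degree R = 0"
    using deg kappa_neq_0 by (simp add: R degree_mult_eq kappa_monic(1))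
  then obtain c where "R = [:c:]" by (elim degree_eq_zeroE)
  with R top kappa_monic show ?thesis by simp
qed

lemma Knat_factor:
  "\<exists>P. Knat lam = smult (kappa lam) P \<and> degree P = N \<and> coeff P 0 = 1"
proof (intro exI conjI)
  define P where "P = map_poly (\<lambda>q. q div kappa lam) (Knat lam)"
  show P: "Knat lam = smult (kappa lam) P"
    by (rule poly_eqI) (simp add: P_def coeff_map_poly kappa_dvd)
  show "degree P = N"
    using degree_Knat kappa_neq_0 unfolding P by simp
  show "coeff P 0 = 1"
    using kappa_neq_0 by (simp add: P_def coeff_map_poly coeff_Knat_0)
qed

section \<open>Supports and the identity for the exceptional polynomials\<close>

lemma not_Iset_iff: "n \<notin> Iset lam \<longleftrightarrow> (\<exists>i\<ge>1. n = pm lam i + int N)"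
proof -
  have "n \<in> Iset lam \<longleftrightarrow> n - int N \<notin> Mset lam"
    by (auto simp: Iset_def Jset_def intro!: exI[of _ "n - int N"])
  then show ?thesis by (force simp: Mset_def)
qed

text \<open>A point outside \<open>Iset lam\<close> is \<open>pm lam i + int N\<close>. For
  \<open>i \<le> N\<close> all coefficients vanish there; for larger \<open>i\<close> the point is
  negative, and \<open>f\<close> is 0 at it and at all points further left.\<close>

lemma shift_op_support:
  assumes "module scale" and f: "{n. f n \<noteq> 0} \<subseteq> {0..}"
  shows "{n. shift_op scale (Knat lam) f n \<noteq> 0} \<subseteq> Iset lam"
proof -
  interpret Modules.module scale by fact
  have "shift_op scale (Knat lam) f n = 0" if "n \<notin> Iset lam" for n
  proof -
    from that obtain i where i: "1 \<le> i" "n = pm lam i + int N" by (auto simp: not_Iset_iff)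
    show ?thesis
    proof (cases "i \<le> N")
      case True
      then show ?thesis
        using poly_coeff_Knat_root[OF i(1)] by (simp add: shift_op_def i(2))
    next
      case False
      then have "n < 0"
        using i(2) part_len_le_size by (simp add: pm_def lam_0)
      then have "f (n - 2 * int j) = 0" for j
        using f by force
      then show ?thesis by (simp add: shift_op_def)
    qed
  qed
  then show ?thesis by auto
qed

text \<open>The factors with \<open>i > l\<close>, where \<open>lam i = 0\<close>, form the falling
  factorial of \<open>lin_ext_cop_KP\<close>; the others are the denominators of
  \<open>exc_hermite\<close>.\<close>

lemma poly_kappa:
  "poly (kappa lam) (of_int n) =
     ff (N - l) n * (\<Prod>i = 1..l. of_int (n - int N + int l - pk lam i))"
proof -
  have "poly (kappa lam) (of_int n) = (\<Prod>i\<in>{1..l} \<union> {Suc l..N}. of_int (n - (pm lam i + int N)))"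
    using part_len_le_size by (auto simp: kappa_def poly_prod intro!: prod.cong)
  also have "\<dots> = (\<Prod>i = 1..l. of_int (n - (pm lam i + int N))) *
      (\<Prod>i = Suc l..N. of_int (n - (pm lam i + int N)))"
    by (rule prod.union_disjoint) auto
  also have "(\<Prod>i = Suc l..N. of_int (n - (pm lam i + int N))) = (\<Prod>r<N - l. complex_of_int n - of_nat r)"
    by (rule prod.reindex_bij_witness[of _ "\<lambda>r. N - r" "\<lambda>i. N - i"]) (auto simp: pm_def lam_0 of_nat_diff)
  also have "\<dots> = ff (N - l) n"
    by (simp add: ff_def ffact_poly_def poly_prod)
  also have "(\<Prod>i = 1..l. complex_of_int (n - (pm lam i + int N))) =
      (\<Prod>i = 1..l. of_int (n - int N + int l - pk lam i))"
    by (rule prod.cong) (auto simp: pk_def)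
  finally show ?thesis by (simp only: mult.commute)
qed

lemma kappa_exc_hermite:
  assumes "n \<in> Iset lam"
  shows "smult [:poly (kappa lam) (of_int n):] (exc_hermite lam n) = shift_op smult (Knat lam) Hpoly n"
proof -
  define D where "D = (\<Prod>i = 1..l. complex_of_int (n - int N + int l - pk lam i))"
  \<comment> \<open>Membership in \<open>Iset lam\<close> is what keeps the denominator of
    \<open>exc_hermite\<close> nonzero.\<close>
  have "n - int N + int l - pk lam i \<noteq> 0" if "1 \<le> i" for i
    using assms that not_Iset_iff[of n] by (auto simp: pk_def)
  then have "D \<noteq> 0" by (simp add: D_def del: of_int_diff of_int_add)
  then have "ff (N - l) n * D * (1 / (vander lam * D)) = ff (N - l) n / vander lam"
    by simp
  then show ?thesis
    unfolding shift_op_Knat lin_ext_cop_KP exc_hermite_def Let_def poly_kappa D_def[symmetric]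
    by (simp only: smult_smult mult_pCons_left) simp
qed

end

theorem theorem4p15:
  fixes lam :: "nat \<Rightarrow> nat" and N :: nat
  assumes "is_partition lam" and "N = part_size lam"
  shows
    "(\<exists>P :: complex poly poly.
        Knat lam = smult (kappa lam) P \<and> degree P = N \<and> coeff P 0 = 1) \<and>
     (\<forall>(scale :: complex poly \<Rightarrow> 'b::ab_group_add \<Rightarrow> 'b) (f :: int \<Rightarrow> 'b).
        module scale \<longrightarrow> {n. f n \<noteq> 0} \<subseteq> {0..} \<longrightarrow>
        {n. shift_op scale (Knat lam) f n \<noteq> 0} \<subseteq> Iset lam) \<and>
     (\<forall>n\<in>Iset lam.
        smult [:poly (kappa lam) (of_int n):] (exc_hermite lam n) =
        shift_op smult (Knat lam) Hpoly n)"
proof -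
  interpret partition lam by unfold_locales fact
  show ?thesis
    using Knat_factor shift_op_support kappa_exc_hermite assms(2) by blast
qed

end
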